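(* Let $\mathscr{M}$ be an $n$-dimensional complete manifold and let $g_{ij}(x,t)$ be a smooth family of Riemannian metrics on $\mathscr{M}$ evolving under the hyperbolic geometric flow $$\frac{\partial^2 g_{ij}}{\partial t^2}=-2R_{ij}.$$ Then the Riemannian curvature tensor $R_{ijkl}$ satisfies the evolution equation $$ \begin{aligned} \frac{\partial^2}{\partial t^2}R_{ijkl}={}&\triangle R_{ijkl}+2\left(B_{ijkl}-B_{ijlk}-B_{iljk}+B_{ikjl}\right)\\ &-g^{pq}\left(R_{pjkl}R_{qi}+R_{ipkl}R_{qj}+R_{ijpl}R_{qk}+R_{ijkp}R_{ql}\right)\\ &+2g_{pq}\left(\frac{\partial\Gamma^{p}_{il}}{\partial t}\frac{\partial\Gamma^{q}_{jk}}{\partial t}-\frac{\partial\Gamma^{p}_{jl}}{\partial t}\frac{\partial\Gamma^{q}_{ik}}{\partial t}\right), \end{aligned} $$ where $B_{ijkl}=g^{pr}g^{qs}R_{piqj}R_{rksl}$ and $\triangle$ is the Laplacian with respect to the evolving metric.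
   Context: All curvature quantities are those of the evolving metric $g_{ij}(\cdot,t)$; summation over repeated indices. Conventions: $\Gamma^{k}_{ij}=\frac12 g^{kl}\left(\frac{\partial g_{jl}}{\partial x^i}+\frac{\partial g_{il}}{\partial x^j}-\frac{\partial g_{ij}}{\partial x^l}\right)$, $R^{k}_{ijl}=\frac{\partial\Gamma^{k}_{jl}}{\partial x^i}-\frac{\partial\Gamma^{k}_{il}}{\partial x^j}+\Gamma^{k}_{ip}\Gamma^{p}_{jl}-\Gamma^{k}_{jp}\Gamma^{p}_{il}$, $R_{ijkl}=g_{kp}R^{p}_{ijl}$, and Ricci tensor $R_{ik}=g^{jl}R_{ijkl}$. On tensors, $\triangle=g^{pq}\nabla_p\nabla_q$ with $\nabla$ the Levi-Civita connection of $g_{ij}(\cdot,t)$. The time derivative $\frac{\partial}{\partial t}\Gamma^{p}_{ij}$ of the Christoffel symbols is a tensor, so the last term is coordinate-independent. *)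

theory Defs
  imports "HOL-Analysis.Analysis"
begin

section \<open>Smooth functions\<close>

definition partial :: "'n::finite \<Rightarrow> (real^'n \<Rightarrow> real) \<Rightarrow> real^'n \<Rightarrow> real" where
  "partial i f x = deriv (\<lambda>s. f (x + s *\<^sub>R axis i 1)) 0"

text \<open>On an open set this is \<open>C\<^sup>\<infinity>\<close>: a list of indices encodes an iterated partial derivative,
  and the empty list gives \<open>f\<close> itself.\<close>

definition smooth_on :: "(real^'n::finite) set \<Rightarrow> (real^'n \<Rightarrow> real) \<Rightarrow> bool" where
  "smooth_on \<Omega> f \<longleftrightarrow> (\<forall>js :: 'n list. foldr partial js f differentiable_on \<Omega>)"

text \<open>The time interval \<open>I\<close> may contain endpoints (as in \<open>[0,T)\<close>); the derivative there is one-sided.\<close>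

definition time_deriv ::
    "real set \<Rightarrow> (real \<Rightarrow> real^'n::finite \<Rightarrow> real) \<Rightarrow> real \<Rightarrow> real^'n \<Rightarrow> real" where
  "time_deriv I f t x = vector_derivative (\<lambda>s. f s x) (at t within I)"

text \<open>Joint smoothness in time and space: all iterated derivatives, in any order, of
  \<open>\<partial>/\<partial>t\<close> (encoded by \<open>None\<close>) and \<open>\<partial>/\<partial>x\<^sup>i\<close> (encoded by \<open>Some i\<close>) are differentiable
  on \<open>I \<times> \<Omega>\<close>.\<close>

definition spacetime_deriv ::
    "real set \<Rightarrow> 'n::finite option \<Rightarrow> (real \<Rightarrow> real^'n \<Rightarrow> real) \<Rightarrow> real \<Rightarrow> real^'n \<Rightarrow> real" where
  "spacetime_deriv I m f =
     (case m of None \<Rightarrow> time_deriv I f | Some i \<Rightarrow> (\<lambda>t. partial i (f t)))"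

definition smooth_family_on ::
    "real set \<Rightarrow> (real^'n::finite) set \<Rightarrow> (real \<Rightarrow> real^'n \<Rightarrow> real) \<Rightarrow> bool" where
  "smooth_family_on I \<Omega> f \<longleftrightarrow>
     (\<forall>ms :: 'n option list.
        (\<lambda>(t, x). foldr (spacetime_deriv I) ms f t x) differentiable_on (I \<times> \<Omega>))"

section \<open>Smooth manifolds\<close>

text \<open>A chart is a pair \<open>(U, \<phi>)\<close>; the values of \<open>\<phi>\<close> outside \<open>U\<close> are irrelevant.
  The dimension of the manifold is \<open>CARD('n)\<close>.\<close>

type_synonym ('a, 'n) chart = "'a set \<times> ('a \<Rightarrow> real^'n)"

definition chart_image :: "('a, 'n::finite) chart \<Rightarrow> (real^'n) set" where
  "chart_image c = snd c ` fst c"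

definition transition ::
    "('a, 'n::finite) chart \<Rightarrow> ('a, 'n) chart \<Rightarrow> real^'n \<Rightarrow> real^'n" where
  "transition c d = snd d \<circ> inv_into (fst c) (snd c)"

definition smooth_manifold :: "'a topology \<Rightarrow> ('a, 'n::finite) chart set \<Rightarrow> bool" where
  "smooth_manifold X A \<longleftrightarrow>
     Hausdorff_space X \<and> second_countable X \<and>
     topspace X = (\<Union>c\<in>A. fst c) \<and>
     (\<forall>c\<in>A. openin X (fst c) \<and> open (chart_image c) \<and>
        homeomorphic_map (subtopology X (fst c)) (top_of_set (chart_image c)) (snd c)) \<and>
     (\<forall>c\<in>A. \<forall>d\<in>A. \<forall>a.
        smooth_on (snd c ` (fst c \<inter> fst d)) (\<lambda>x. transition c d x $ a))"

section \<open>Riemannian metrics\<close>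

text \<open>A metric is given by its component matrices \<open>(h\<^sub>i\<^sub>j)\<close> in the charts of the atlas,
  as functions of the coordinates, subject to the tensor transformation law.\<close>

definition riemannian_metric ::
    "('a, 'n::finite) chart set \<Rightarrow> (('a, 'n) chart \<Rightarrow> real^'n \<Rightarrow> real^'n^'n) \<Rightarrow> bool" where
  "riemannian_metric A h \<longleftrightarrow>
     (\<forall>c\<in>A. (\<forall>i j. smooth_on (chart_image c) (\<lambda>x. h c x $ i $ j)) \<and>
        (\<forall>x\<in>chart_image c. transpose (h c x) = h c x \<and> (\<forall>v. v \<noteq> 0 \<longrightarrow> v \<bullet> (h c x *v v) > 0))) \<and>
     (\<forall>c\<in>A. \<forall>d\<in>A. \<forall>p\<in>fst c \<inter> fst d. \<forall>i j.
        h c (snd c p) $ i $ j =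
          (\<Sum>a\<in>UNIV. \<Sum>b\<in>UNIV.
             partial i (\<lambda>x. transition c d x $ a) (snd c p) *
             partial j (\<lambda>x. transition c d x $ b) (snd c p) * h d (snd d p) $ a $ b))"

definition smooth_metric_family ::
    "('a, 'n::finite) chart set \<Rightarrow> real set \<Rightarrow>
     (('a, 'n) chart \<Rightarrow> real \<Rightarrow> real^'n \<Rightarrow> real^'n^'n) \<Rightarrow> bool" where
  "smooth_metric_family A I g \<longleftrightarrow>
     (\<forall>t\<in>I. riemannian_metric A (\<lambda>c. g c t)) \<and>
     (\<forall>c\<in>A. \<forall>i j. smooth_family_on I (chart_image c) (\<lambda>t x. g c t x $ i $ j))"

section \<open>Completeness\<close>

definition C1_curve ::
    "'a topology \<Rightarrow> ('a, 'n::finite) chart set \<Rightarrow> (real \<Rightarrow> 'a) \<Rightarrow> bool" where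
  "C1_curve X A \<gamma> \<longleftrightarrow>
     continuous_map (top_of_set {0..1}) X \<gamma> \<and>
     (\<forall>c\<in>A. \<exists>v. continuous_on {s\<in>{0..1}. \<gamma> s \<in> fst c} v \<and>
        (\<forall>s\<in>{0..1}. \<gamma> s \<in> fst c \<longrightarrow>
           ((snd c \<circ> \<gamma>) has_vector_derivative v s) (at s within {0..1})))"

text \<open>By the transformation law the speed does not depend on the chosen chart around \<open>\<gamma> s\<close>.\<close>

definition curve_speed ::
    "('a, 'n::finite) chart set \<Rightarrow> (('a, 'n) chart \<Rightarrow> real^'n \<Rightarrow> real^'n^'n) \<Rightarrow>
     (real \<Rightarrow> 'a) \<Rightarrow> real \<Rightarrow> real" where
  "curve_speed A h \<gamma> s =
     (let c = (SOME c. c \<in> A \<and> \<gamma> s \<in> fst c);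
          v = vector_derivative (snd c \<circ> \<gamma>) (at s within {0..1})
      in sqrt (v \<bullet> (h c (snd c (\<gamma> s)) *v v)))"

text \<open>Piecewise \<open>C\<^sup>1\<close> curves give the same infimum, since the velocity of a curve is allowed to
  vanish: a corner can be traversed with velocity zero. The distance is \<open>\<infinity>\<close> between
  different connected components.\<close>

definition riemannian_dist ::
    "'a topology \<Rightarrow> ('a, 'n::finite) chart set \<Rightarrow>
     (('a, 'n) chart \<Rightarrow> real^'n \<Rightarrow> real^'n^'n) \<Rightarrow> 'a \<Rightarrow> 'a \<Rightarrow> ereal" where
  "riemannian_dist X A h p q =
     (INF \<gamma>\<in>{\<gamma>. C1_curve X A \<gamma> \<and> \<gamma> 0 = p \<and> \<gamma> 1 = q}.
        ereal (integral {0..1} (curve_speed A h \<gamma>)))"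

definition complete_metric ::
    "'a topology \<Rightarrow> ('a, 'n::finite) chart set \<Rightarrow>
     (('a, 'n) chart \<Rightarrow> real^'n \<Rightarrow> real^'n^'n) \<Rightarrow> bool" where
  "complete_metric X A h \<longleftrightarrow>
     (\<forall>\<sigma> :: nat \<Rightarrow> 'a. range \<sigma> \<subseteq> topspace X \<longrightarrow>
        (\<forall>e>0. \<exists>N. \<forall>m\<ge>N. \<forall>n\<ge>N. riemannian_dist X A h (\<sigma> m) (\<sigma> n) < ereal e) \<longrightarrow>
        (\<exists>p\<in>topspace X. (\<lambda>n. riemannian_dist X A h (\<sigma> n) p) \<longlonglongrightarrow> 0))"

section \<open>Curvature in local coordinates\<close>

definition inv_metric :: "(real^'n::finite \<Rightarrow> real^'n^'n) \<Rightarrow> 'n \<Rightarrow> 'n \<Rightarrow> real^'n \<Rightarrow> real" where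
  "inv_metric h i j x = matrix_inv (h x) $ i $ j"

text \<open>\<open>christoffel h k i j\<close> is \<open>\<Gamma>\<^sup>k\<^sub>i\<^sub>j\<close>; the upper index comes first.\<close>

definition christoffel ::
    "(real^'n::finite \<Rightarrow> real^'n^'n) \<Rightarrow> 'n \<Rightarrow> 'n \<Rightarrow> 'n \<Rightarrow> real^'n \<Rightarrow> real" where
  "christoffel h k i j x =
     (1/2) * (\<Sum>l\<in>UNIV. inv_metric h k l x *
       (partial i (\<lambda>y. h y $ j $ l) x + partial j (\<lambda>y. h y $ i $ l) x
        - partial l (\<lambda>y. h y $ i $ j) x))"

text \<open>\<open>riemann_up h k i j l\<close> is \<open>R\<^sup>k\<^sub>i\<^sub>j\<^sub>l\<close>. The index is lowered into the third slot:
  \<open>R\<^sub>i\<^sub>j\<^sub>k\<^sub>l = g\<^sub>k\<^sub>p R\<^sup>p\<^sub>i\<^sub>j\<^sub>l\<close>.\<close>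

definition riemann_up ::
    "(real^'n::finite \<Rightarrow> real^'n^'n) \<Rightarrow> 'n \<Rightarrow> 'n \<Rightarrow> 'n \<Rightarrow> 'n \<Rightarrow> real^'n \<Rightarrow> real" where
  "riemann_up h k i j l x =
     partial i (christoffel h k j l) x - partial j (christoffel h k i l) x
     + (\<Sum>p\<in>UNIV. christoffel h k i p x * christoffel h p j l x
                 - christoffel h k j p x * christoffel h p i l x)"

definition riemann ::
    "(real^'n::finite \<Rightarrow> real^'n^'n) \<Rightarrow> 'n \<Rightarrow> 'n \<Rightarrow> 'n \<Rightarrow> 'n \<Rightarrow> real^'n \<Rightarrow> real" where
  "riemann h i j k l x = (\<Sum>p\<in>UNIV. h x $ k $ p * riemann_up h p i j l x)"

definition ricci ::
    "(real^'n::finite \<Rightarrow> real^'n^'n) \<Rightarrow> 'n \<Rightarrow> 'n \<Rightarrow> real^'n \<Rightarrow> real" where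
  "ricci h i k x = (\<Sum>j\<in>UNIV. \<Sum>l\<in>UNIV. inv_metric h j l x * riemann h i j k l x)"

definition B_tensor ::
    "(real^'n::finite \<Rightarrow> real^'n^'n) \<Rightarrow> 'n \<Rightarrow> 'n \<Rightarrow> 'n \<Rightarrow> 'n \<Rightarrow> real^'n \<Rightarrow> real" where
  "B_tensor h i j k l x =
     (\<Sum>p\<in>UNIV. \<Sum>q\<in>UNIV. \<Sum>r\<in>UNIV. \<Sum>s\<in>UNIV.
        inv_metric h p r x * inv_metric h q s x * riemann h p i q j x * riemann h r k s l x)"

text \<open>Components of a covariant tensor of rank \<open>r\<close> are indexed by lists of length \<open>r\<close>.
  The differentiation index of \<open>\<nabla>T\<close> comes first:
  \<open>cov_deriv h T (p # js)\<close> is \<open>\<nabla>\<^sub>p T\<^sub>j\<^sub>s\<close>. The value at the empty list is irrelevant.\<close>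

fun cov_deriv ::
    "(real^'n::finite \<Rightarrow> real^'n^'n) \<Rightarrow> ('n list \<Rightarrow> real^'n \<Rightarrow> real) \<Rightarrow>
     'n list \<Rightarrow> real^'n \<Rightarrow> real" where
  "cov_deriv h T (p # js) x =
     partial p (T js) x
     - (\<Sum>m<length js. \<Sum>q\<in>UNIV. christoffel h q p (js ! m) x * T (js[m := q]) x)"
| "cov_deriv h T [] x = 0"

definition laplacian ::
    "(real^'n::finite \<Rightarrow> real^'n^'n) \<Rightarrow> ('n list \<Rightarrow> real^'n \<Rightarrow> real) \<Rightarrow>
     'n list \<Rightarrow> real^'n \<Rightarrow> real" where
  "laplacian h T js x =
     (\<Sum>p\<in>UNIV. \<Sum>q\<in>UNIV. inv_metric h p q x * cov_deriv h (cov_deriv h T) (p # q # js) x)"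

definition riemann_tensor ::
    "(real^'n::finite \<Rightarrow> real^'n^'n) \<Rightarrow> 'n list \<Rightarrow> real^'n \<Rightarrow> real" where
  "riemann_tensor h js = riemann h (js ! 0) (js ! 1) (js ! 2) (js ! 3)"

section \<open>The hyperbolic geometric flow\<close>

definition hyperbolic_geometric_flow ::
    "('a, 'n::finite) chart set \<Rightarrow> real set \<Rightarrow>
     (('a, 'n) chart \<Rightarrow> real \<Rightarrow> real^'n \<Rightarrow> real^'n^'n) \<Rightarrow> bool" where
  "hyperbolic_geometric_flow A I g \<longleftrightarrow>
     (\<forall>c\<in>A. \<forall>t\<in>I. \<forall>x\<in>chart_image c. \<forall>i j.
        time_deriv I (time_deriv I (\<lambda>s y. g c s y $ i $ j)) t x = - 2 * ricci (g c t) i j x)"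

end

theory Submission
  imports Defs
begin

text \<open>
  The statement is local: it only concerns the components of the metric in one chart, and the flow
  equation enters once, as the value of \<open>\<partial>\<^sup>2g/\<partial>t\<^sup>2\<close>. Let \<open>[k,ij]\<close> be the lowered Christoffel symbol
  \<open>(\<partial>\<^sub>i g\<^sub>j\<^sub>k + \<partial>\<^sub>j g\<^sub>i\<^sub>k - \<partial>\<^sub>k g\<^sub>i\<^sub>j)/2\<close>, which is linear in \<open>g\<close>. In these terms (\<open>riemann_low\<close>)
  \<open>R\<^sub>i\<^sub>j\<^sub>k\<^sub>l = \<partial>\<^sub>i[k,jl] - \<partial>\<^sub>j[k,il] + [p,jk] \<Gamma>\<^sup>p\<^sub>i\<^sub>l - [p,ik] \<Gamma>\<^sup>p\<^sub>j\<^sub>l\<close>,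
  a linear part plus a quadratic one.

  \<^bold>\<open>Time.\<close> If \<open>gA = a\<close> and \<open>gB = b\<close> with \<open>g\<close> symmetric, then
  \<open>(a\<cdot>B)'' = a''\<cdot>B + A\<cdot>b'' - A\<cdot>g''B + 2 A'\<cdot>gB'\<close>. Applied with \<open>a = [\<cdot>,jk]\<close> and \<open>B = \<Gamma>\<^sub>i\<^sub>l\<close> this shows that
  \<open>\<partial>\<^sup>2R/\<partial>t\<^sup>2\<close> is the sum of the terms in \<open>(\<partial>\<Gamma>/\<partial>t)(\<partial>\<Gamma>/\<partial>t)\<close> of the statement and of an expression
  \<open>riemann_variation\<close> that contains no time derivative except \<open>w = \<partial>\<^sup>2g/\<partial>t\<^sup>2\<close>, linearly: the derivative
  of the curvature tensor at \<open>g\<close> in the direction \<open>w\<close> (\<open>second_time_deriv_riemann\<close>).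

  \<^bold>\<open>Space.\<close> It remains to evaluate this derivative for \<open>w = -2 Ric\<close> at a fixed time, which is the
  computation known from the Ricci flow (\<open>ricci_variation\<close>). In covariant form
  (\<open>riemann_variation_covariant\<close>) it involves the second covariant derivatives of \<open>w\<close>. The contracted
  second Bianchi identity turns \<open>\<nabla>\<^sub>lR\<^sub>j\<^sub>k - \<nabla>\<^sub>kR\<^sub>j\<^sub>l\<close> into the divergence \<open>g\<^sup>m\<^sup>n\<nabla>\<^sub>nR\<^sub>j\<^sub>m\<^sub>k\<^sub>l\<close>; exchanging the
  two covariant derivatives in \<open>g\<^sup>m\<^sup>n\<nabla>\<^sub>i\<nabla>\<^sub>nR\<^sub>j\<^sub>m\<^sub>k\<^sub>l\<close>, antisymmetrizing in \<open>i, j\<close> and using the second Bianchi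
  identity again produces the Laplacian. The commutators are quadratic in the curvature
  (\<open>ricci_identity\<close>), and the symmetries of \<open>R\<close> identify them as the terms in \<open>B\<close> and \<open>Ric\<close>
  (\<open>contracted_commutator\<close>).
\<close>

section \<open>Partial derivatives and smooth functions\<close>

lemma partial_eq_derivative:
  assumes "(f has_derivative D) (at x)"
  shows "partial i f x = D (axis i 1)"
proof -
  have "((\<lambda>s::real. x + s *\<^sub>R axis i 1) has_derivative (\<lambda>s. s *\<^sub>R axis i 1)) (at 0)"
    by (auto intro!: derivative_eq_intros)
  moreover have "(f has_derivative D) (at (x + (0::real) *\<^sub>R axis i 1))"
    using assms by simp
  ultimately have "((\<lambda>s. f (x + s *\<^sub>R axis i 1)) has_derivative (\<lambda>s. D (s *\<^sub>R axis i 1))) (at 0)"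
    using has_derivative_compose by blast
  moreover have "(\<lambda>s. D (s *\<^sub>R axis i 1)) = (*) (D (axis i 1))"
    using linear_cmul[OF has_derivative_linear[OF assms]] by (auto simp: mult.commute)
  ultimately show ?thesis
    unfolding partial_def by (metis DERIV_imp_deriv has_field_derivative_def)
qed

lemma has_partial_along_axis:
  assumes "f differentiable (at (x + s *\<^sub>R axis i 1))"
  shows "((\<lambda>s. f (x + s *\<^sub>R axis i 1)) has_real_derivative partial i f (x + s *\<^sub>R axis i 1)) (at s)"
proof -
  obtain D where D: "(f has_derivative D) (at (x + s *\<^sub>R axis i 1))"
    using assms by (auto simp: differentiable_def)
  have "((\<lambda>s::real. x + s *\<^sub>R axis i 1) has_derivative (\<lambda>s. s *\<^sub>R axis i 1)) (at s)"
    by (auto intro!: derivative_eq_intros)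
  then have "((\<lambda>s. f (x + s *\<^sub>R axis i 1)) has_derivative (\<lambda>s. D (s *\<^sub>R axis i 1))) (at s)"
    using has_derivative_compose D by blast
  moreover have "(\<lambda>s. D (s *\<^sub>R axis i 1)) = (*) (D (axis i 1))"
    using linear_cmul[OF has_derivative_linear[OF D]] by (auto simp: mult.commute)
  ultimately show ?thesis
    using partial_eq_derivative[OF D] by (simp add: has_field_derivative_def)
qed

text \<open>Only the values near \<open>x\<close> matter; hence identities that hold on an open set may be differentiated.\<close>

lemma partial_cong:
  assumes "open \<Omega>" "x \<in> \<Omega>" "\<And>y. y \<in> \<Omega> \<Longrightarrow> f y = g y"
  shows "partial i f x = partial i g x"
  unfolding partial_def
proof (rule deriv_cong_ev)
  have "((\<lambda>s::real. x + s *\<^sub>R axis i 1) \<longlongrightarrow> x + 0 *\<^sub>R axis i 1) (nhds 0)"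
    by (intro tendsto_intros filterlim_ident)
  then have "eventually (\<lambda>s::real. x + s *\<^sub>R axis i 1 \<in> \<Omega>) (nhds 0)"
    using assms(1,2) by (auto elim: topological_tendstoD)
  then show "eventually (\<lambda>s. f (x + s *\<^sub>R axis i 1) = g (x + s *\<^sub>R axis i 1)) (nhds 0)"
    by (rule eventually_mono) (rule assms(3))
qed simp

lemma partial_const [simp]: "partial i (\<lambda>x. c) = (\<lambda>x. 0)"
  unfolding partial_def by (simp add: fun_eq_iff)

lemma
  assumes "f differentiable (at x)" "g differentiable (at x)"
  shows partial_add: "partial i (\<lambda>x. f x + g x) x = partial i f x + partial i g x"
    and partial_diff: "partial i (\<lambda>x. f x - g x) x = partial i f x - partial i g x"
    and partial_mult: "partial i (\<lambda>x. f x * g x) x = partial i f x * g x + f x * partial i g x"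
proof -
  obtain D E where D: "(f has_derivative D) (at x)" and E: "(g has_derivative E) (at x)"
    using assms by (auto simp: differentiable_def)
  note [simp] = partial_eq_derivative[OF D] partial_eq_derivative[OF E]
  show "partial i (\<lambda>x. f x + g x) x = partial i f x + partial i g x"
    using partial_eq_derivative[OF has_derivative_add[OF D E]] by simp
  show "partial i (\<lambda>x. f x - g x) x = partial i f x - partial i g x"
    using partial_eq_derivative[OF has_derivative_diff[OF D E]] by simp
  show "partial i (\<lambda>x. f x * g x) x = partial i f x * g x + f x * partial i g x"
    using partial_eq_derivative[OF has_derivative_mult[OF D E]] by simp
qed

lemma partial_cmult:
  assumes "f differentiable (at x)"
  shows "partial i (\<lambda>x. c * f x) x = c * partial i f x"
  using partial_mult[of "\<lambda>_. c", OF _ assms] by simp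

lemma partial_uminus:
  assumes "f differentiable (at x)"
  shows "partial i (\<lambda>x. - f x) x = - partial i f x"
  using partial_cmult[OF assms, of i "-1"] by simp

lemma partial_inverse:
  assumes "f differentiable (at x)" "f x \<noteq> 0"
  shows "partial i (\<lambda>x. inverse (f x)) x = - (partial i f x * (inverse (f x) * inverse (f x)))"
proof -
  obtain D where D: "(f has_derivative D) (at x)"
    using assms by (auto simp: differentiable_def)
  show ?thesis
    using partial_eq_derivative[OF Deriv.has_derivative_inverse[OF assms(2) D]] partial_eq_derivative[OF D]
    by (simp add: mult.assoc mult.left_commute)
qed

lemma partial_sum:
  assumes "finite J" "\<And>m. m \<in> J \<Longrightarrow> f m differentiable (at x)"
  shows "partial i (\<lambda>x. \<Sum>m\<in>J. f m x) x = (\<Sum>m\<in>J. partial i (f m) x)"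
  using assms
proof (induction J rule: finite_induct)
  case (insert a J)
  then show ?case
    by (simp add: partial_add[of "f a" x "\<lambda>x. \<Sum>m\<in>J. f m x"])
qed simp

text \<open>The definition of smoothness runs through lists of indices from the right, so the first derivative
  to be taken is the last element. Counting the order instead makes closure under the field
  operations an induction by the product and quotient rules: the derivative of a product involves
  the factors themselves, which is why the order has to be allowed to drop
  (\<open>differentiable_upto_mono\<close>).\<close>

fun differentiable_upto :: "nat \<Rightarrow> (real^'n::finite) set \<Rightarrow> (real^'n \<Rightarrow> real) \<Rightarrow> bool" where
  "differentiable_upto 0 \<Omega> f \<longleftrightarrow> True"
| "differentiable_upto (Suc k) \<Omega> f \<longleftrightarrow>
     f differentiable_on \<Omega> \<and> (\<forall>i. differentiable_upto k \<Omega> (partial i f))"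

lemma differentiable_upto_iff:
  "differentiable_upto k \<Omega> f \<longleftrightarrow> (\<forall>js. length js < k \<longrightarrow> foldr partial js f differentiable_on \<Omega>)"
proof (induction k arbitrary: f)
  case (Suc k)
  have "(\<forall>js. length js < Suc k \<longrightarrow> foldr partial js f differentiable_on \<Omega>) \<longleftrightarrow>
     f differentiable_on \<Omega> \<and> (\<forall>i js. length js < k \<longrightarrow> foldr partial js (partial i f) differentiable_on \<Omega>)"
    (is "?L \<longleftrightarrow> ?R")
  proof
    assume L: ?L
    have "foldr partial js (partial i f) differentiable_on \<Omega>" if "length js < k" for i js
      using L[rule_format, of "js @ [i]"] that by simp
    then show ?R using L[rule_format, of "[]"] by simp
  next
    assume R: ?R
    show ?L
    proof (intro allI impI)
      fix js :: "'a list" assume "length js < Suc k"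
      then show "foldr partial js f differentiable_on \<Omega>"
        using R by (cases js rule: rev_cases) auto
    qed
  qed
  then show ?case using Suc.IH by auto
qed simp

lemma smooth_on_iff_upto: "smooth_on \<Omega> f \<longleftrightarrow> (\<forall>k. differentiable_upto k \<Omega> f)"
  unfolding smooth_on_def differentiable_upto_iff by auto

lemma smooth_on_differentiable: "smooth_on \<Omega> f \<Longrightarrow> f differentiable_on \<Omega>"
  unfolding smooth_on_iff_upto by (metis differentiable_upto.simps(2))

lemma smooth_on_at: "smooth_on \<Omega> f \<Longrightarrow> open \<Omega> \<Longrightarrow> x \<in> \<Omega> \<Longrightarrow> f differentiable (at x)"
  using smooth_on_differentiable differentiable_on_eq_differentiable_at by blast

lemma smooth_on_partial: "smooth_on \<Omega> f \<Longrightarrow> smooth_on \<Omega> (partial i f)"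
  unfolding smooth_on_iff_upto by (metis differentiable_upto.simps(2))

lemma differentiable_upto_mono: "differentiable_upto (Suc k) \<Omega> f \<Longrightarrow> differentiable_upto k \<Omega> f"
  unfolding differentiable_upto_iff by auto

context
  fixes \<Omega> :: "(real^'n::finite) set"
  assumes \<Omega>: "open \<Omega>"
begin

lemma differentiable_upto_at:
  "differentiable_upto (Suc k) \<Omega> f \<Longrightarrow> x \<in> \<Omega> \<Longrightarrow> f differentiable (at x)"
  using differentiable_on_eq_differentiable_at[OF \<Omega>] by auto

lemma differentiable_upto_cong:
  assumes "differentiable_upto k \<Omega> f" "\<And>x. x \<in> \<Omega> \<Longrightarrow> f x = g x"
  shows "differentiable_upto k \<Omega> g"
  using assms
proof (induction k arbitrary: f g)
  case (Suc k)
  have "f differentiable_on \<Omega>" using Suc.prems by simp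
  then have "g differentiable_on \<Omega>"
    using Suc.prems(2) by (metis differentiable_transform_within differentiable_on_def zero_less_one)
  moreover have "differentiable_upto k \<Omega> (partial i g)" for i
  proof (rule Suc.IH)
    show "differentiable_upto k \<Omega> (partial i f)" using Suc.prems by simp
    show "partial i f x = partial i g x" if "x \<in> \<Omega>" for x
      using partial_cong[OF \<Omega> that] Suc.prems(2) by blast
  qed
  ultimately show ?case by simp
qed simp

lemma differentiable_upto_const: "differentiable_upto k \<Omega> (\<lambda>x. c)"
proof (induction k arbitrary: c)
  case (Suc k)
  then show ?case
    by simp
qed simp

lemma differentiable_upto_add:
  "differentiable_upto k \<Omega> f \<Longrightarrow> differentiable_upto k \<Omega> g \<Longrightarrow>
    differentiable_upto k \<Omega> (\<lambda>x. f x + g x)"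
proof (induction k arbitrary: f g)
  case (Suc k)
  have "differentiable_upto k \<Omega> (partial i (\<lambda>x. f x + g x))" for i
  proof (rule differentiable_upto_cong)
    show "differentiable_upto k \<Omega> (\<lambda>x. partial i f x + partial i g x)"
      using Suc.prems by (intro Suc.IH) simp_all
    show "partial i f x + partial i g x = partial i (\<lambda>x. f x + g x) x" if "x \<in> \<Omega>" for x
      using Suc.prems[THEN differentiable_upto_at[OF _ that]] by (simp add: partial_add)
  qed
  then show ?case using Suc.prems by auto
qed simp

lemma differentiable_upto_mult:
  "differentiable_upto k \<Omega> f \<Longrightarrow> differentiable_upto k \<Omega> g \<Longrightarrow>
    differentiable_upto k \<Omega> (\<lambda>x. f x * g x)"
proof (induction k arbitrary: f g)
  case (Suc k)
  have lower: "differentiable_upto k \<Omega> f" "differentiable_upto k \<Omega> g"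
    using Suc.prems differentiable_upto_mono by blast+
  have "differentiable_upto k \<Omega> (partial i (\<lambda>x. f x * g x))" for i
  proof (rule differentiable_upto_cong)
    show "differentiable_upto k \<Omega> (\<lambda>x. partial i f x * g x + f x * partial i g x)"
      using Suc.prems lower by (intro differentiable_upto_add Suc.IH) simp_all
    show "partial i f x * g x + f x * partial i g x = partial i (\<lambda>x. f x * g x) x" if "x \<in> \<Omega>" for x
      using Suc.prems[THEN differentiable_upto_at[OF _ that]] by (simp add: partial_mult)
  qed
  then show ?case using Suc.prems by auto
qed simp

lemma differentiable_upto_inverse:
  assumes "\<And>x. x \<in> \<Omega> \<Longrightarrow> f x \<noteq> 0"
  shows "differentiable_upto k \<Omega> f \<Longrightarrow> differentiable_upto k \<Omega> (\<lambda>x. inverse (f x))"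
proof (induction k)
  case (Suc k)
  have lower: "differentiable_upto k \<Omega> (\<lambda>x. inverse (f x))"
    using Suc differentiable_upto_mono by blast
  have "differentiable_upto k \<Omega> (partial i (\<lambda>x. inverse (f x)))" for i
  proof (rule differentiable_upto_cong)
    show "differentiable_upto k \<Omega> (\<lambda>x. -1 * (partial i f x * (inverse (f x) * inverse (f x))))"
      using Suc.prems lower
      by (intro differentiable_upto_mult differentiable_upto_const) auto
    show "-1 * (partial i f x * (inverse (f x) * inverse (f x))) = partial i (\<lambda>x. inverse (f x)) x"
      if "x \<in> \<Omega>" for x
      using Suc.prems[THEN differentiable_upto_at[OF _ that]] assms[OF that] by (simp add: partial_inverse)
  qed
  then show ?case using Suc.prems assms by auto
qed simp

lemma smooth_on_cong:
  assumes "smooth_on \<Omega> f" "\<And>x. x \<in> \<Omega> \<Longrightarrow> f x = g x"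
  shows "smooth_on \<Omega> g"
  using assms differentiable_upto_cong unfolding smooth_on_iff_upto by blast

lemma smooth_on_const: "smooth_on \<Omega> (\<lambda>x. c)"
  unfolding smooth_on_iff_upto using differentiable_upto_const by blast

lemma smooth_on_add: "smooth_on \<Omega> f \<Longrightarrow> smooth_on \<Omega> g \<Longrightarrow> smooth_on \<Omega> (\<lambda>x. f x + g x)"
  unfolding smooth_on_iff_upto using differentiable_upto_add by blast

lemma smooth_on_mult: "smooth_on \<Omega> f \<Longrightarrow> smooth_on \<Omega> g \<Longrightarrow> smooth_on \<Omega> (\<lambda>x. f x * g x)"
  unfolding smooth_on_iff_upto using differentiable_upto_mult by blast

lemma smooth_on_inverse:
  "smooth_on \<Omega> f \<Longrightarrow> (\<And>x. x \<in> \<Omega> \<Longrightarrow> f x \<noteq> 0) \<Longrightarrow> smooth_on \<Omega> (\<lambda>x. inverse (f x))"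
  unfolding smooth_on_iff_upto using differentiable_upto_inverse by blast

lemma smooth_on_diff: "smooth_on \<Omega> f \<Longrightarrow> smooth_on \<Omega> g \<Longrightarrow> smooth_on \<Omega> (\<lambda>x. f x - g x)"
  using smooth_on_add[of f, OF _ smooth_on_mult[OF smooth_on_const[of "-1"], of g]] by simp

lemma smooth_on_sum:
  "finite J \<Longrightarrow> (\<And>m. m \<in> J \<Longrightarrow> smooth_on \<Omega> (f m)) \<Longrightarrow> smooth_on \<Omega> (\<lambda>x. \<Sum>m\<in>J. f m x)"
  by (induction J rule: finite_induct) (simp_all add: smooth_on_const smooth_on_add)

end

section \<open>Inverse matrices\<close>

lemma matrix_inv_unique:
  fixes M :: "'a::field^'n^'n"
  assumes "M ** B = mat 1"
  shows "matrix_inv M = B"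
proof -
  have B: "B ** M = mat 1" using assms matrix_left_right_inverse by blast
  then have "M ** matrix_inv M = mat 1 \<and> matrix_inv M ** M = mat 1"
    unfolding matrix_inv_def using assms by (rule_tac someI[of _ B]) simp
  then show ?thesis by (metis B matrix_mul_assoc matrix_mul_lid matrix_mul_rid)
qed

lemma matrix_inv_right_inverse:
  fixes M :: "'a::field^'n^'n"
  assumes "det M \<noteq> 0"
  shows "M ** matrix_inv M = mat 1"
  using assms invertible_det_nz invertible_def matrix_inv_unique by metis

text \<open>Column \<open>l\<close> of the inverse solves \<open>M v = e\<^sub>l\<close>, so its entries are given by Cramer's rule.\<close>

lemma matrix_inv_cramer:
  fixes M :: "'a::field^'n^'n"
  assumes "det M \<noteq> 0"
  shows "matrix_inv M $ k $ l = det (\<chi> i j. if j = k then axis l 1 $ i else M $ i $ j) * inverse (det M)"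
proof -
  have "M *v column l (matrix_inv M) = axis l 1"
    using arg_cong[OF matrix_inv_right_inverse[OF assms], of "column l"]
    by (auto simp: vec_eq_iff matrix_matrix_mult_def matrix_vector_mult_def column_def mat_def axis_def)
  then have "column l (matrix_inv M) $ k = det (\<chi> i j. if j = k then axis l 1 $ i else M $ i $ j) / det M"
    using cramer[OF assms, of "column l (matrix_inv M)" "axis l 1"] by simp
  then show ?thesis by (simp add: column_def divide_inverse)
qed

text \<open>By Cramer's rule the entries of the inverse are rational functions of the entries. The class \<open>P\<close> is
  kept abstract because two instances occur: smooth functions of the space variable, and
  differentiable functions of time.\<close>

lemma matrix_inv_entry_closed:
  fixes M :: "'b \<Rightarrow> real^'n^'n"
  assumes const: "\<And>c. P (\<lambda>x. c)"
    and add: "\<And>f g. P f \<Longrightarrow> P g \<Longrightarrow> P (\<lambda>x. f x + g x)"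
    and mult: "\<And>f g. P f \<Longrightarrow> P g \<Longrightarrow> P (\<lambda>x. f x * g x)"
    and inverse: "\<And>f. P f \<Longrightarrow> (\<And>x. x \<in> S \<Longrightarrow> f x \<noteq> 0) \<Longrightarrow> P (\<lambda>x. inverse (f x))"
    and cong: "\<And>f g. P f \<Longrightarrow> (\<And>x. x \<in> S \<Longrightarrow> f x = g x) \<Longrightarrow> P g"
    and nonsingular: "\<And>x. x \<in> S \<Longrightarrow> det (M x) \<noteq> 0"
    and entries: "\<And>i j. P (\<lambda>x. M x $ i $ j)"
  shows "P (\<lambda>x. matrix_inv (M x) $ k $ l)"
proof -
  have sum: "P (\<lambda>x. \<Sum>m\<in>J. f m x)" if "finite J" "\<And>m. m \<in> J \<Longrightarrow> P (f m)" for J and f :: "_ \<Rightarrow> 'b \<Rightarrow> real"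
    using that by (induction J rule: finite_induct) (simp_all add: const add)
  have prod: "P (\<lambda>x. \<Prod>m\<in>J. f m x)" if "finite J" "\<And>m. m \<in> J \<Longrightarrow> P (f m)" for J and f :: "_ \<Rightarrow> 'b \<Rightarrow> real"
    using that by (induction J rule: finite_induct) (simp_all add: const mult)
  have det: "P (\<lambda>x. det (N x))" if "\<And>i j. P (\<lambda>x. N x $ i $ j)" for N :: "'b \<Rightarrow> real^'n^'n"
    unfolding det_def using that by (intro sum mult const prod) simp_all
  have "P (\<lambda>x. (\<chi> i j. if j = k then axis l 1 $ i else M x $ i $ j) $ i $ j)" for i j
    using entries const by (cases "j = k") simp_all
  then have "P (\<lambda>x. det (\<chi> i j. if j = k then axis l 1 $ i else M x $ i $ j) * inverse (det (M x)))"
    using nonsingular entries by (intro mult det inverse) auto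
  then show ?thesis
    by (rule cong) (simp add: matrix_inv_cramer nonsingular)
qed

section \<open>Mixed derivatives\<close>

text \<open>The second difference of \<open>u\<close> over the rectangle, by the mean value theorem first in \<open>s\<close> and then
  in \<open>t\<close>. All derivatives are one-sided at the edges.\<close>

lemma mixed_derivatives_meet:
  fixes u us ust :: "real \<Rightarrow> real \<Rightarrow> real"
  assumes "a < b" "c < d"
    and us: "\<And>t s. t \<in> {a..b} \<Longrightarrow> s \<in> {c..d} \<Longrightarrow> ((\<lambda>s. u t s) has_real_derivative us t s) (at s within {c..d})"
    and ust: "\<And>t s. t \<in> {a..b} \<Longrightarrow> s \<in> {c..d} \<Longrightarrow> ((\<lambda>t. us t s) has_real_derivative ust t s) (at t within {a..b})"
  obtains \<xi> \<eta> where "\<xi> \<in> {a..b}" "\<eta> \<in> {c..d}"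
    "u b d - u b c - u a d + u a c = (b - a) * (d - c) * ust \<xi> \<eta>"
proof -
  let ?f = "\<lambda>s. u b s - u a s"
  have f: "((\<lambda>s. u b s - u a s) has_real_derivative us b s - us a s) (at s within {c..d})"
    if "c \<le> s" "s \<le> d" for s
    using that assms(1) by (intro DERIV_diff us) auto
  obtain \<eta> where \<eta>: "\<eta> \<in> {c<..<d}" "?f d - ?f c = (us b \<eta> - us a \<eta>) * (d - c)"
    using mvt_simple[OF assms(2), of ?f "\<lambda>s h. (us b s - us a s) * h"] f
    by (auto simp: has_field_derivative_def)
  obtain \<xi> where \<xi>: "\<xi> \<in> {a<..<b}" "us b \<eta> - us a \<eta> = ust \<xi> \<eta> * (b - a)"
    using mvt_simple[OF assms(1), of "\<lambda>t. us t \<eta>" "\<lambda>t h. ust t \<eta> * h"] ust \<eta>(1)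
    by (auto simp: has_field_derivative_def)
  show ?thesis
  proof
    show "\<xi> \<in> {a..b}" "\<eta> \<in> {c..d}" using \<xi>(1) \<eta>(1) by auto
    show "u b d - u b c - u a d + u a c = (b - a) * (d - c) * ust \<xi> \<eta>"
      using \<eta>(2) \<xi>(2) by (simp add: algebra_simps)
  qed
qed

lemma small_subinterval:
  fixes t :: real
  assumes "a < b" "t \<in> {a..b}" "0 < \<delta>"
  obtains a' b' where "a' < b'" "t \<in> {a'..b'}" "{a'..b'} \<subseteq> {a..b}" "\<And>s. s \<in> {a'..b'} \<Longrightarrow> \<bar>s - t\<bar> < \<delta>"
proof (cases "t < b")
  case True
  show ?thesis
    by (rule that[of t "min b (t + \<delta>/2)"]) (use True assms in auto)
next
  case False
  show ?thesis
    by (rule that[of "max a (t - \<delta>/2)" t]) (use False assms in auto)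
qed

text \<open>Symmetry of mixed derivatives. The second difference over a small rectangle is, up to the area, a
  value of each of the two mixed derivatives nearby; continuity then forces them to agree. The point
  may lie on the boundary of the rectangle: this is needed when time is an endpoint of the interval.\<close>

lemma mixed_derivatives_eq:
  fixes u us ut ust uts :: "real \<Rightarrow> real \<Rightarrow> real"
  assumes ab: "a < b" "t0 \<in> {a..b}" and cd: "c < d" "s0 \<in> {c..d}"
    and us: "\<And>t s. t \<in> {a..b} \<Longrightarrow> s \<in> {c..d} \<Longrightarrow> ((\<lambda>s. u t s) has_real_derivative us t s) (at s within {c..d})"
    and ust: "\<And>t s. t \<in> {a..b} \<Longrightarrow> s \<in> {c..d} \<Longrightarrow> ((\<lambda>t. us t s) has_real_derivative ust t s) (at t within {a..b})"
    and ut: "\<And>t s. t \<in> {a..b} \<Longrightarrow> s \<in> {c..d} \<Longrightarrow> ((\<lambda>t. u t s) has_real_derivative ut t s) (at t within {a..b})"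
    and uts: "\<And>t s. t \<in> {a..b} \<Longrightarrow> s \<in> {c..d} \<Longrightarrow> ((\<lambda>s. ut t s) has_real_derivative uts t s) (at s within {c..d})"
    and cont: "continuous_on ({a..b} \<times> {c..d}) (\<lambda>(t, s). ust t s)"
      "continuous_on ({a..b} \<times> {c..d}) (\<lambda>(t, s). uts t s)"
  shows "ust t0 s0 = uts t0 s0"
proof (rule ccontr)
  assume ne: "ust t0 s0 \<noteq> uts t0 s0"
  define e where "e = \<bar>ust t0 s0 - uts t0 s0\<bar> / 2"
  have e: "e > 0" using ne by (simp add: e_def)
  have "\<exists>d1>0. \<forall>z\<in>{a..b} \<times> {c..d}. dist z (t0,s0) < d1 \<longrightarrow> dist ((\<lambda>(t, s). ust t s) z) (ust t0 s0) < e"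
    using cont(1)[unfolded continuous_on_iff, rule_format, of "(t0,s0)" e] ab cd e by auto
  then obtain d1 where d1: "d1 > 0"
    "\<And>t s. t \<in> {a..b} \<Longrightarrow> s \<in> {c..d} \<Longrightarrow> dist (t,s) (t0,s0) < d1 \<Longrightarrow> \<bar>ust t s - ust t0 s0\<bar> < e"
    by (fastforce simp: dist_real_def)
  have "\<exists>d2>0. \<forall>z\<in>{a..b} \<times> {c..d}. dist z (t0,s0) < d2 \<longrightarrow> dist ((\<lambda>(t, s). uts t s) z) (uts t0 s0) < e"
    using cont(2)[unfolded continuous_on_iff, rule_format, of "(t0,s0)" e] ab cd e by auto
  then obtain d2 where d2: "d2 > 0"
    "\<And>t s. t \<in> {a..b} \<Longrightarrow> s \<in> {c..d} \<Longrightarrow> dist (t,s) (t0,s0) < d2 \<Longrightarrow> \<bar>uts t s - uts t0 s0\<bar> < e"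
    by (fastforce simp: dist_real_def)
  define \<delta> where "\<delta> = min d1 d2 / 2"
  have \<delta>: "\<delta> > 0" using d1(1) d2(1) by (simp add: \<delta>_def)
  obtain a' b' where ab': "a' < b'" "t0 \<in> {a'..b'}" "{a'..b'} \<subseteq> {a..b}" "\<And>s. s \<in> {a'..b'} \<Longrightarrow> \<bar>s - t0\<bar> < \<delta>"
    using small_subinterval[OF ab \<delta>] by metis
  obtain c' d' where cd': "c' < d'" "s0 \<in> {c'..d'}" "{c'..d'} \<subseteq> {c..d}" "\<And>s. s \<in> {c'..d'} \<Longrightarrow> \<bar>s - s0\<bar> < \<delta>"
    using small_subinterval[OF cd \<delta>] by metis
  have near: "dist (t,s) (t0,s0) < min d1 d2" if "t \<in> {a'..b'}" "s \<in> {c'..d'}" for t s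
    using ab'(4)[OF that(1)] cd'(4)[OF that(2)] real_sqrt_sum_squares_triangle_ineq[of "t - t0" 0 0 "s - s0"]
    by (auto simp: dist_prod_def dist_real_def \<delta>_def)
  obtain \<xi> \<eta> where 1: "\<xi> \<in> {a'..b'}" "\<eta> \<in> {c'..d'}"
    "u b' d' - u b' c' - u a' d' + u a' c' = (b' - a') * (d' - c') * ust \<xi> \<eta>"
  proof (rule mixed_derivatives_meet[OF ab'(1) cd'(1), of u us ust])
    fix t s assume ts: "t \<in> {a'..b'}" "s \<in> {c'..d'}"
    then have ts': "t \<in> {a..b}" "s \<in> {c..d}" using ab'(3) cd'(3) by blast+
    show "((\<lambda>s. u t s) has_real_derivative us t s) (at s within {c'..d'})"
      using DERIV_subset[OF us[OF ts'] cd'(3)] .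
    show "((\<lambda>t. us t s) has_real_derivative ust t s) (at t within {a'..b'})"
      using DERIV_subset[OF ust[OF ts'] ab'(3)] .
  qed
  obtain \<xi>' \<eta>' where 2: "\<xi>' \<in> {c'..d'}" "\<eta>' \<in> {a'..b'}"
    "u b' d' - u a' d' - u b' c' + u a' c' = (d' - c') * (b' - a') * uts \<eta>' \<xi>'"
  proof (rule mixed_derivatives_meet[OF cd'(1) ab'(1), of "\<lambda>s t. u t s" "\<lambda>s t. ut t s" "\<lambda>s t. uts t s"])
    fix s t assume ts: "s \<in> {c'..d'}" "t \<in> {a'..b'}"
    then have ts': "t \<in> {a..b}" "s \<in> {c..d}" using ab'(3) cd'(3) by blast+
    show "((\<lambda>t. u t s) has_real_derivative ut t s) (at t within {a'..b'})"
      using DERIV_subset[OF ut[OF ts'] ab'(3)] .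
    show "((\<lambda>s. ut t s) has_real_derivative uts t s) (at s within {c'..d'})"
      using DERIV_subset[OF uts[OF ts'] cd'(3)] .
  qed
  have "(b' - a') * (d' - c') * ust \<xi> \<eta> = (b' - a') * (d' - c') * uts \<eta>' \<xi>'"
    using 1(3) 2(3) by (simp add: algebra_simps)
  then have "ust \<xi> \<eta> = uts \<eta>' \<xi>'" using ab'(1) cd'(1) by simp
  moreover have "\<bar>ust \<xi> \<eta> - ust t0 s0\<bar> < e"
    using d1(2)[of \<xi> \<eta>] near[OF 1(1,2)] 1(1,2) ab'(3) cd'(3) by auto
  moreover have "\<bar>uts \<eta>' \<xi>' - uts t0 s0\<bar> < e"
    using d2(2)[of \<eta>' \<xi>'] near[OF 2(2,1)] 2(1,2) ab'(3) cd'(3) by auto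
  ultimately show False unfolding e_def by (smt (verit) field_sum_of_halves)
qed


text \<open>The function \<open>u\<close> of two real variables is \<open>f\<close> on a small parallelogram
  \<open>P a b = x + a e\<^sub>i + b e\<^sub>j\<close>; it degenerates for \<open>i = j\<close>, which does no harm.\<close>

lemma partial_commute:
  assumes \<Omega>: "open \<Omega>" "x \<in> \<Omega>" and f: "smooth_on \<Omega> f"
  shows "partial i (partial j f) x = partial j (partial i f) x"
proof -
  obtain e where e: "e > 0" "ball x e \<subseteq> \<Omega>"
    using \<Omega> open_contains_ball by blast
  \<comment> \<open>The points of the parallelogram have distance at most \<open>2r < e\<close> from \<open>x\<close>.\<close>
  define r where "r = e / 3"
  define P where "P a b = x + a *\<^sub>R axis i 1 + b *\<^sub>R axis j (1::real)" for a b
  have P': "P a b = x + b *\<^sub>R axis j 1 + a *\<^sub>R axis i 1" for a b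
    by (simp add: P_def)
  have r: "r > 0" using e by (simp add: r_def)
  have P\<Omega>: "P a b \<in> \<Omega>" if "a \<in> {-r..r}" "b \<in> {-r..r}" for a b
  proof -
    have "dist (P a b) x = norm (a *\<^sub>R axis i 1 + b *\<^sub>R axis j (1::real))"
      by (simp add: P_def dist_norm)
    also have "\<dots> \<le> \<bar>a\<bar> + \<bar>b\<bar>"
      by (rule norm_triangle_le) simp
    also have "\<dots> < e" using that r by (auto simp: r_def)
    finally show ?thesis using e(2) by (auto simp: dist_commute)
  qed
  have along_j: "((\<lambda>b. F (P a b)) has_real_derivative partial j F (P a b)) (at b within {-r..r})"
    if "smooth_on \<Omega> F" "a \<in> {-r..r}" "b \<in> {-r..r}" for F a b
    unfolding P_def
    by (rule has_field_derivative_at_within, rule has_partial_along_axis)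
       (use smooth_on_at[OF that(1) \<Omega>(1) P\<Omega>[OF that(2,3)]] in \<open>simp add: P_def\<close>)
  have along_i: "((\<lambda>a. F (P a b)) has_real_derivative partial i F (P a b)) (at a within {-r..r})"
    if "smooth_on \<Omega> F" "a \<in> {-r..r}" "b \<in> {-r..r}" for F a b
    unfolding P'
    by (rule has_field_derivative_at_within, rule has_partial_along_axis)
       (use smooth_on_at[OF that(1) \<Omega>(1) P\<Omega>[OF that(2,3)]] in \<open>simp add: P'\<close>)
  have cont: "continuous_on ({-r..r} \<times> {-r..r}) (\<lambda>(a, b). F (P a b))" if "smooth_on \<Omega> F" for F
  proof -
    have "continuous_on ({-r..r} \<times> {-r..r}) (\<lambda>z. P (fst z) (snd z))"
      unfolding P_def by (intro continuous_intros)
    moreover have "(\<lambda>z. P (fst z) (snd z)) ` ({-r..r} \<times> {-r..r}) \<subseteq> \<Omega>" using P\<Omega> by auto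
    ultimately have "continuous_on ({-r..r} \<times> {-r..r}) (\<lambda>z. F (P (fst z) (snd z)))"
      using continuous_on_compose2[OF differentiable_imp_continuous_on[OF smooth_on_differentiable[OF that]]]
      by blast
    then show ?thesis by (simp add: case_prod_unfold)
  qed
  note smooth = f smooth_on_partial[OF f] smooth_on_partial[OF smooth_on_partial[OF f]]
  have "partial i (partial j f) (P 0 0) = partial j (partial i f) (P 0 0)"
    by (rule mixed_derivatives_eq[of "-r" r 0 "-r" r 0 "\<lambda>a b. f (P a b)" "\<lambda>a b. partial j f (P a b)"
          "\<lambda>a b. partial i (partial j f) (P a b)" "\<lambda>a b. partial i f (P a b)"
          "\<lambda>a b. partial j (partial i f) (P a b)"])
       (use r smooth in \<open>auto intro: along_i along_j cont[unfolded case_prod_unfold] simp: case_prod_unfold\<close>)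
  then show ?thesis by (simp add: P_def)
qed

section \<open>Smooth families of functions\<close>

lemma smooth_family_differentiable:
  "smooth_family_on I \<Omega> f \<Longrightarrow> (\<lambda>(t, x). f t x) differentiable_on (I \<times> \<Omega>)"
  unfolding smooth_family_on_def by (drule spec[of _ "[]"]) simp

lemma smooth_family_spacetime_deriv:
  assumes "smooth_family_on I \<Omega> f"
  shows "smooth_family_on I \<Omega> (spacetime_deriv I m f)"
  unfolding smooth_family_on_def
proof
  fix ms
  show "(\<lambda>(t, x). foldr (spacetime_deriv I) ms (spacetime_deriv I m f) t x) differentiable_on (I \<times> \<Omega>)"
    using assms unfolding smooth_family_on_def by (drule_tac x="ms @ [m]" in spec) simp
qed

lemma smooth_family_time_deriv: "smooth_family_on I \<Omega> f \<Longrightarrow> smooth_family_on I \<Omega> (time_deriv I f)"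
  using smooth_family_spacetime_deriv[of I \<Omega> f None] by (simp add: spacetime_deriv_def)

lemma smooth_family_partial:
  "smooth_family_on I \<Omega> f \<Longrightarrow> smooth_family_on I \<Omega> (\<lambda>t. partial i (f t))"
  using smooth_family_spacetime_deriv[of I \<Omega> f "Some i"] by (simp add: spacetime_deriv_def)

lemma smooth_family_slice:
  assumes "smooth_family_on I \<Omega> f" "t \<in> I"
  shows "smooth_on \<Omega> (f t)"
proof -
  have diff: "f t differentiable_on \<Omega>" if "smooth_family_on I \<Omega> f" for f
  proof -
    have "((\<lambda>x. (t, x)) has_derivative (\<lambda>h. (0, h))) (at x within \<Omega>)" for x
      by (auto intro!: derivative_eq_intros)
    then have "(\<lambda>x. (t, x)) differentiable_on \<Omega>"
      unfolding differentiable_on_def differentiable_def by blast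
    moreover have "(\<lambda>(t, x). f t x) differentiable_on ((\<lambda>x. (t, x)) ` \<Omega>)"
      using smooth_family_differentiable[OF that] assms(2)
      by (rule_tac differentiable_on_subset) auto
    ultimately have "(\<lambda>x. (\<lambda>(t, x). f t x) (t, x)) differentiable_on \<Omega>"
      by (rule differentiable_on_compose)
    then show ?thesis by simp
  qed
  have "\<exists>F. smooth_family_on I \<Omega> F \<and> F t = foldr partial js (f t)" for js
  proof (induction js)
    case (Cons j js)
    then show ?case using smooth_family_partial by fastforce
  qed (use assms in auto)
  then show ?thesis unfolding smooth_on_def using diff by metis
qed

lemma has_time_deriv:
  assumes "smooth_family_on I \<Omega> f" "t \<in> I" "x \<in> \<Omega>"
  shows "((\<lambda>s. f s x) has_real_derivative time_deriv I f t x) (at t within I)"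
proof -
  have "((\<lambda>s. (s, x)) has_derivative (\<lambda>h. (h, 0))) (at t within I)" for t
    by (auto intro!: derivative_eq_intros)
  then have "(\<lambda>s. (s, x)) differentiable_on I"
    unfolding differentiable_on_def differentiable_def by blast
  moreover have "(\<lambda>(t, x). f t x) differentiable_on ((\<lambda>s. (s, x)) ` I)"
    using smooth_family_differentiable[OF assms(1)] assms(3)
    by (rule_tac differentiable_on_subset) auto
  ultimately have "(\<lambda>s. (\<lambda>(t, x). f t x) (s, x)) differentiable_on I"
    by (rule differentiable_on_compose)
  then have "(\<lambda>s. f s x) differentiable (at t within I)"
    using assms(2) by (simp add: differentiable_on_def)
  then show ?thesis
    unfolding time_deriv_def has_real_derivative_iff_has_vector_derivative
    using vector_derivative_works by blast
qed

text \<open>Time derivatives are taken within \<open>I\<close>. A nondegenerate interval around \<open>t\<close> inside \<open>I\<close> makes them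
  unique, even if \<open>t\<close> is an endpoint of \<open>I\<close>.\<close>

lemma nondegenerate_interval_at:
  fixes I :: "real set"
  assumes "is_interval I" "interior I \<noteq> {}" "t \<in> I"
  obtains a b where "a < b" "t \<in> {a..b}" "{a..b} \<subseteq> I"
proof -
  obtain y e where y: "e > 0" "ball y e \<subseteq> I" 
    using assms(2) by (metis equals0I mem_interior)
  have "y - e/2 \<in> I" "y + e/2 \<in> I" using y by (auto simp: dist_real_def subset_eq)
  moreover define z where "z = (if t = y - e/2 then y + e/2 else y - e/2)"
  ultimately have z: "z \<in> I" "z \<noteq> t" using y(1) by auto
  have sub: "{min t z..max t z} \<subseteq> I"
  proof
    fix s assume s: "s \<in> {min t z..max t z}"
    show "s \<in> I"
    proof (cases "t \<le> z")
      case True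
      then show ?thesis using mem_is_interval_1_I[OF assms(1) assms(3) z(1), of s] s by simp
    next
      case False
      then show ?thesis using mem_is_interval_1_I[OF assms(1) z(1) assms(3), of s] s by simp
    qed
  qed
  show ?thesis
    by (rule that[of "min t z" "max t z"]) (use z sub in auto)
qed

text \<open>As \<open>t\<close> may be an endpoint of \<open>I\<close>, the rectangle is \<open>[a,b] \<times> [-r,r]\<close> with \<open>t\<close> in \<open>[a,b] \<subseteq> I\<close>
  rather than a neighbourhood of the point.\<close>

lemma time_deriv_partial_commute:
  assumes I: "is_interval I" "interior I \<noteq> {}" and \<Omega>: "open \<Omega>"
    and f: "smooth_family_on I \<Omega> f" and t: "t \<in> I" and x: "x \<in> \<Omega>"
  shows "time_deriv I (\<lambda>t. partial i (f t)) t x = partial i (time_deriv I f t) x"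
proof -
  obtain a b where ab: "a < b" "t \<in> {a..b}" "{a..b} \<subseteq> I"
    using nondegenerate_interval_at[OF I t] .
  obtain e where e: "e > 0" "ball x e \<subseteq> \<Omega>"
    using \<Omega> x open_contains_ball by blast
  define r where "r = e / 2"
  define P where "P s = x + s *\<^sub>R axis i (1::real)" for s
  have r: "r > 0" using e by (simp add: r_def)
  have P\<Omega>: "P s \<in> \<Omega>" if "s \<in> {-r..r}" for s
    using that e r by (auto simp: P_def dist_norm r_def subset_eq)
  have along_x: "((\<lambda>s. F t (P s)) has_real_derivative partial i (F t) (P s)) (at s within {-r..r})"
    if "smooth_family_on I \<Omega> F" "t \<in> {a..b}" "s \<in> {-r..r}" for F t s
    unfolding P_def
    by (rule has_field_derivative_at_within, rule has_partial_along_axis)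
       (use smooth_on_at[OF smooth_family_slice[OF that(1), of t] \<Omega> P\<Omega>[OF that(3)]] that ab(3)
        in \<open>auto simp: P_def\<close>)
  have along_t: "((\<lambda>t. F t (P s)) has_real_derivative time_deriv I F t (P s)) (at t within {a..b})"
    if "smooth_family_on I \<Omega> F" "t \<in> {a..b}" "s \<in> {-r..r}" for F t s
    using has_time_deriv[OF that(1) _ P\<Omega>[OF that(3)]] that(2) ab(3) DERIV_subset by blast
  have cont: "continuous_on ({a..b} \<times> {-r..r}) (\<lambda>(t, s). F t (P s))"
    if "smooth_family_on I \<Omega> F" for F
  proof -
    have "continuous_on ({a..b} \<times> {-r..r}) (\<lambda>z. (fst z, P (snd z)))"
      unfolding P_def by (intro continuous_intros)
    moreover have "(\<lambda>z. (fst z, P (snd z))) ` ({a..b} \<times> {-r..r}) \<subseteq> I \<times> \<Omega>"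
      using P\<Omega> ab(3) by auto
    ultimately have "continuous_on ({a..b} \<times> {-r..r}) (\<lambda>z. (\<lambda>(t, x). F t x) (fst z, P (snd z)))"
      using continuous_on_compose2[OF differentiable_imp_continuous_on[OF smooth_family_differentiable[OF that]]]
      by blast
    then show ?thesis by (simp add: case_prod_unfold)
  qed
  note smooth = f smooth_family_time_deriv[OF f] smooth_family_partial[OF f]
    smooth_family_time_deriv[OF smooth_family_partial[OF f]]
    smooth_family_partial[OF smooth_family_time_deriv[OF f]]
  have "time_deriv I (\<lambda>t. partial i (f t)) t (P 0) = partial i (time_deriv I f t) (P 0)"
  proof (rule mixed_derivatives_eq[of a b t "-r" r 0 "\<lambda>t s. f t (P s)" "\<lambda>t s. partial i (f t) (P s)"
          "\<lambda>t s. time_deriv I (\<lambda>t. partial i (f t)) t (P s)" "\<lambda>t s. time_deriv I f t (P s)"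
          "\<lambda>t s. partial i (time_deriv I f t) (P s)"])
    show "((\<lambda>t. partial i (f t) (P s)) has_real_derivative time_deriv I (\<lambda>t. partial i (f t)) t (P s))
       (at t within {a..b})" if "t \<in> {a..b}" "s \<in> {-r..r}" for t s
      using along_t[OF smooth(3) that] .
  qed (use ab r smooth cont[OF smooth(4)] cont[OF smooth(5)] in \<open>auto intro: along_x along_t\<close>)
  then show ?thesis by (simp add: P_def)
qed

lemma has_real_derivative_time_derivI:
  assumes I: "is_interval I" "interior I \<noteq> {}" "t \<in> I"
    and "((\<lambda>s. f s x) has_real_derivative D) (at t within I)"
  shows "time_deriv I f t x = D"
proof -
  obtain a b where ab: "a < b" "t \<in> {a..b}" "{a..b} \<subseteq> I"
    using nondegenerate_interval_at[OF I] .
  have "at t within {a..b} \<noteq> bot"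
    using ab islimpt_Icc[of a b t] by (auto simp: trivial_limit_within)
  then have "at t within I \<noteq> bot"
    using at_le[OF ab(3), of t] by (metis bot.extremum_uniqueI)
  then show ?thesis
    unfolding time_deriv_def
    using assms(4) by (simp add: vector_derivative_within has_real_derivative_iff_has_vector_derivative)
qed



section \<open>A metric on an open set\<close>

text \<open>Nondegeneracy is assumed in the form in which Cramer's rule needs it; for a Riemannian metric it
  follows from positive definiteness (\<open>det_nonzero_if_positive_definite\<close>).\<close>

locale metric_on =
  fixes \<Omega> :: "(real^'n::finite) set" and h :: "real^'n \<Rightarrow> real^'n^'n"
  assumes open_domain: "open \<Omega>"
    and smooth_metric: "\<And>i j. smooth_on \<Omega> (\<lambda>x. h x $ i $ j)"
    and metric_commute: "\<And>x i j. x \<in> \<Omega> \<Longrightarrow> h x $ i $ j = h x $ j $ i"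
    and nonsingular: "\<And>x. x \<in> \<Omega> \<Longrightarrow> det (h x) \<noteq> 0"
begin

abbreviation G :: "'n \<Rightarrow> 'n \<Rightarrow> real^'n \<Rightarrow> real" where "G \<equiv> inv_metric h"
abbreviation \<Gamma> :: "'n \<Rightarrow> 'n \<Rightarrow> 'n \<Rightarrow> real^'n \<Rightarrow> real" where "\<Gamma> \<equiv> christoffel h"

lemmas smooth_rules =
  smooth_on_const[OF open_domain] smooth_on_add[OF open_domain] smooth_on_diff[OF open_domain]
  smooth_on_mult[OF open_domain] smooth_on_sum[OF open_domain finite] smooth_on_partial smooth_metric

lemma smooth_at: "smooth_on \<Omega> f \<Longrightarrow> x \<in> \<Omega> \<Longrightarrow> f differentiable (at x)"
  using smooth_on_at open_domain by blast

lemma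
  assumes "smooth_on \<Omega> f" "smooth_on \<Omega> g" "x \<in> \<Omega>"
  shows partial_smooth_add: "partial i (\<lambda>x. f x + g x) x = partial i f x + partial i g x"
    and partial_smooth_diff: "partial i (\<lambda>x. f x - g x) x = partial i f x - partial i g x"
    and partial_smooth_mult: "partial i (\<lambda>x. f x * g x) x = partial i f x * g x + f x * partial i g x"
  using assms by (simp_all add: partial_add partial_diff partial_mult smooth_at)

lemma partial_smooth_cmult:
  "smooth_on \<Omega> f \<Longrightarrow> x \<in> \<Omega> \<Longrightarrow> partial i (\<lambda>x. c * f x) x = c * partial i f x"
  by (simp add: partial_cmult smooth_at)

lemma partial_smooth_uminus:
  "smooth_on \<Omega> f \<Longrightarrow> x \<in> \<Omega> \<Longrightarrow> partial i (\<lambda>x. - f x) x = - partial i f x"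
  by (simp add: partial_uminus smooth_at)

lemma partial_smooth_sum:
  "(\<And>m. smooth_on \<Omega> (f m)) \<Longrightarrow> x \<in> \<Omega> \<Longrightarrow>
    partial i (\<lambda>x. \<Sum>m\<in>(UNIV :: 'b::finite set). f m x) x = (\<Sum>m\<in>UNIV. partial i (f m) x)"
  by (simp add: partial_sum smooth_at)

lemmas partial_rules = partial_smooth_add partial_smooth_diff partial_smooth_mult
  partial_smooth_cmult partial_smooth_uminus partial_smooth_sum

lemma smooth_inverse_metric: "smooth_on \<Omega> (G i j)"
  unfolding inv_metric_def
  by (rule matrix_inv_entry_closed[where P = "smooth_on \<Omega>" and S = \<Omega>])
     (use smooth_on_cong[OF open_domain] smooth_on_inverse[OF open_domain] nonsingular
      in \<open>auto intro: smooth_rules\<close>)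

lemma smooth_christoffel: "smooth_on \<Omega> (\<Gamma> k i j)"
  unfolding christoffel_def[abs_def]
  by (intro smooth_rules smooth_inverse_metric)

lemma metric_inverse: "x \<in> \<Omega> \<Longrightarrow> (\<Sum>q\<in>UNIV. h x $ i $ q * G q j x) = (if i = j then 1 else 0)"
  using arg_cong[OF matrix_inv_right_inverse[OF nonsingular], of x "\<lambda>M. M $ i $ j"]
  by (simp add: inv_metric_def matrix_matrix_mult_def mat_def)

lemma inverse_metric: "x \<in> \<Omega> \<Longrightarrow> (\<Sum>q\<in>UNIV. G i q x * h x $ q $ j) = (if i = j then 1 else 0)"
proof -
  assume "x \<in> \<Omega>"
  then have "matrix_inv (h x) ** h x = mat 1"
    using matrix_inv_right_inverse nonsingular matrix_left_right_inverse by blast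
  from arg_cong[OF this, of "\<lambda>M. M $ i $ j"] show ?thesis
    by (simp add: inv_metric_def matrix_matrix_mult_def mat_def)
qed

lemma inverse_metric_commute:
  assumes x: "x \<in> \<Omega>"
  shows "G i j x = G j i x"
proof -
  have "transpose (h x) = h x"
    using metric_commute[OF x] by (auto simp: transpose_def vec_eq_iff)
  then have "transpose (matrix_inv (h x)) ** h x = mat 1"
    using matrix_transpose_mul[of "h x" "matrix_inv (h x)"] matrix_inv_right_inverse[OF nonsingular[OF x]]
    by simp
  then have "h x ** transpose (matrix_inv (h x)) = mat 1"
    using matrix_left_right_inverse by blast
  then have "matrix_inv (h x) = transpose (matrix_inv (h x))"
    by (rule matrix_inv_unique)
  then have "matrix_inv (h x) $ i $ j = transpose (matrix_inv (h x)) $ i $ j"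
    by (rule arg_cong)
  then show ?thesis
    by (simp add: inv_metric_def transpose_def)
qed

end

text \<open>The Christoffel symbol of the first kind \<open>[k,ij]\<close>, the upper index of \<open>\<Gamma>\<^sup>k\<^sub>i\<^sub>j\<close> being lowered. It is
  defined for any family \<open>w\<close> of functions since it will also be applied to the time derivatives of the
  metric and to the Ricci tensor.\<close>

definition christoffel_low ::
    "('n::finite \<Rightarrow> 'n \<Rightarrow> real^'n \<Rightarrow> real) \<Rightarrow> 'n \<Rightarrow> 'n \<Rightarrow> 'n \<Rightarrow> real^'n \<Rightarrow> real" where
  "christoffel_low w k i j x =
     1/2 * (partial i (w j k) x + partial j (w i k) x - partial k (w i j) x)"

context metric_on
begin

abbreviation low :: "'n \<Rightarrow> 'n \<Rightarrow> 'n \<Rightarrow> real^'n \<Rightarrow> real" where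
  "low \<equiv> christoffel_low (\<lambda>i j x. h x $ i $ j)"

lemma metric_partial_commute: "x \<in> \<Omega> \<Longrightarrow> partial k (\<lambda>x. h x $ i $ j) x = partial k (\<lambda>x. h x $ j $ i) x"
  by (rule partial_cong[OF open_domain]) (auto intro: metric_commute)

lemma christoffel_eq_low: "\<Gamma> k i j x = (\<Sum>l\<in>UNIV. G k l x * low l i j x)"
  by (simp add: christoffel_def christoffel_low_def sum_distrib_left mult.left_commute)

lemma low_commute: "x \<in> \<Omega> \<Longrightarrow> low k i j x = low k j i x"
  using metric_partial_commute[of x] by (simp add: christoffel_low_def)

lemma christoffel_commute: "x \<in> \<Omega> \<Longrightarrow> \<Gamma> k i j x = \<Gamma> k j i x"
  using low_commute[of x] by (simp add: christoffel_eq_low)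

lemma lower_christoffel:
  assumes x: "x \<in> \<Omega>"
  shows "(\<Sum>k\<in>UNIV. h x $ l $ k * \<Gamma> k i j x) = low l i j x"
proof -
  have "(\<Sum>k\<in>UNIV. h x $ l $ k * \<Gamma> k i j x) = (\<Sum>k\<in>UNIV. \<Sum>m\<in>UNIV. h x $ l $ k * G k m x * low m i j x)"
    by (simp add: christoffel_eq_low sum_distrib_left mult.assoc)
  also have "\<dots> = (\<Sum>m\<in>UNIV. (\<Sum>k\<in>UNIV. h x $ l $ k * G k m x) * low m i j x)"
    by (subst sum.swap) (simp add: sum_distrib_right)
  also have "\<dots> = low l i j x"
    by (simp add: metric_inverse[OF x] if_distrib[of "\<lambda>a. a * _"] cong: if_cong)
  finally show ?thesis .
qed

lemma partial_metric_low:
  assumes x: "x \<in> \<Omega>"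
  shows "partial i (\<lambda>x. h x $ j $ k) x = low k i j x + low j i k x"
  using metric_partial_commute[OF x] by (simp add: christoffel_low_def field_simps)

text \<open>This is \<open>\<nabla>g = 0\<close> written out.\<close>

lemma partial_metric:
  assumes x: "x \<in> \<Omega>"
  shows "partial i (\<lambda>x. h x $ j $ k) x = (\<Sum>m\<in>UNIV. h x $ k $ m * \<Gamma> m i j x + h x $ j $ m * \<Gamma> m i k x)"
  by (simp add: sum.distrib lower_christoffel[OF x] partial_metric_low[OF x])

lemma smooth_low: "smooth_on \<Omega> (low k i j)"
  unfolding christoffel_low_def[abs_def] by (intro smooth_rules)

lemmas smooth_facts = smooth_rules smooth_inverse_metric smooth_christoffel smooth_low

lemma smooth_riemann_up: "smooth_on \<Omega> (riemann_up h k i j l)"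
  unfolding riemann_up_def[abs_def] by (intro smooth_facts)

lemma smooth_riemann: "smooth_on \<Omega> (riemann h i j k l)"
  unfolding riemann_def[abs_def] by (intro smooth_facts smooth_riemann_up)

lemma smooth_ricci: "smooth_on \<Omega> (ricci h i j)"
  unfolding ricci_def[abs_def] by (intro smooth_facts smooth_riemann)

section \<open>Algebraic symmetries of the curvature tensor\<close>

text \<open>Differentiating \<open>g\<^sub>k\<^sub>p \<Gamma>\<^sup>p\<^sub>j\<^sub>l = [k,jl]\<close> replaces \<open>g\<^sub>k\<^sub>p \<partial>\<^sub>i\<Gamma>\<^sup>p\<^sub>j\<^sub>l\<close> by \<open>\<partial>\<^sub>i[k,jl]\<close> minus
  \<open>([k,ip] + [p,ik]) \<Gamma>\<^sup>p\<^sub>j\<^sub>l\<close>; the terms in \<open>[k,ip]\<close> cancel the quadratic terms of the curvature.\<close>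

lemma riemann_low:
  assumes x: "x \<in> \<Omega>"
  shows "riemann h i j k l x = partial i (low k j l) x - partial j (low k i l) x
    + (\<Sum>p\<in>UNIV. low p j k x * \<Gamma> p i l x - low p i k x * \<Gamma> p j l x)"
proof -
  have dlow: "partial i (low k j l) x =
     (\<Sum>p\<in>UNIV. (low k i p x + low p i k x) * \<Gamma> p j l x + h x $ k $ p * partial i (\<Gamma> p j l) x)" for i j
  proof -
    have "partial i (low k j l) x = partial i (\<lambda>y. \<Sum>p\<in>UNIV. h y $ k $ p * \<Gamma> p j l y) x"
      by (rule partial_cong[OF open_domain x]) (simp add: lower_christoffel)
    also have "\<dots> = (\<Sum>p\<in>UNIV. partial i (\<lambda>y. h y $ k $ p) x * \<Gamma> p j l x + h x $ k $ p * partial i (\<Gamma> p j l) x)"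
      by (simp add: partial_rules smooth_facts x)
    finally show ?thesis by (simp add: partial_metric_low[OF x] add.commute)
  qed
  have quad: "(\<Sum>p\<in>UNIV. h x $ k $ p * (\<Sum>q\<in>UNIV. \<Gamma> p i q x * \<Gamma> q j l x))
      = (\<Sum>q\<in>UNIV. low k i q x * \<Gamma> q j l x)" for i j
    unfolding sum_distrib_left
    by (subst sum.swap) (simp add: lower_christoffel[OF x, symmetric] sum_distrib_right mult.assoc)
  have "riemann h i j k l x = (\<Sum>p\<in>UNIV. h x $ k $ p * partial i (\<Gamma> p j l) x)
     - (\<Sum>p\<in>UNIV. h x $ k $ p * partial j (\<Gamma> p i l) x)
     + (\<Sum>p\<in>UNIV. h x $ k $ p * (\<Sum>q\<in>UNIV. \<Gamma> p i q x * \<Gamma> q j l x))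
     - (\<Sum>p\<in>UNIV. h x $ k $ p * (\<Sum>q\<in>UNIV. \<Gamma> p j q x * \<Gamma> q i l x))"
    unfolding riemann_def riemann_up_def
    by (simp add: distrib_left right_diff_distrib sum.distrib sum_subtractf)
  then show ?thesis
    unfolding quad dlow by (simp add: sum.distrib sum_subtractf algebra_simps)
qed

lemma low_pairing_commute:
  assumes x: "x \<in> \<Omega>"
  shows "(\<Sum>p\<in>UNIV. low p a b x * \<Gamma> p c d x) = (\<Sum>p\<in>UNIV. low p c d x * \<Gamma> p a b x)"
proof -
  have expand: "(\<Sum>p\<in>UNIV. low p a b x * \<Gamma> p c d x) = (\<Sum>p\<in>UNIV. \<Sum>q\<in>UNIV. G p q x * low p a b x * low q c d x)" for a b c d
    by (simp add: christoffel_eq_low sum_distrib_left mult.left_commute mult.assoc)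
  have "(\<Sum>p\<in>UNIV. \<Sum>q\<in>UNIV. G p q x * low p a b x * low q c d x) =
      (\<Sum>p\<in>UNIV. \<Sum>q\<in>UNIV. G p q x * low p c d x * low q a b x)"
    by (subst sum.swap, intro sum.cong refl) (simp add: inverse_metric_commute[OF x] mult_ac)
  then show ?thesis by (simp only: expand)
qed

lemma second_partials_metric_commute:
  assumes x: "x \<in> \<Omega>"
  shows "partial p (partial q (\<lambda>x. h x $ i $ j)) x = partial q (partial p (\<lambda>x. h x $ i $ j)) x"
    "partial p (partial q (\<lambda>x. h x $ i $ j)) x = partial p (partial q (\<lambda>x. h x $ j $ i)) x"
  by (auto intro!: partial_commute[OF open_domain x] smooth_metric partial_cong[OF open_domain x] metric_partial_commute)

text \<open>In this form the curvature tensor is visibly symmetric under exchange of its two pairs of indices.\<close>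

lemma riemann_second_partials:
  assumes x: "x \<in> \<Omega>"
  shows "riemann h i j k l x =
    1/2 * (partial i (partial l (\<lambda>x. h x $ j $ k)) x - partial i (partial k (\<lambda>x. h x $ j $ l)) x
         - partial j (partial l (\<lambda>x. h x $ i $ k)) x + partial j (partial k (\<lambda>x. h x $ i $ l)) x)
    + (\<Sum>p\<in>UNIV. low p j k x * \<Gamma> p i l x) - (\<Sum>p\<in>UNIV. low p i k x * \<Gamma> p j l x)"
proof -
  have "partial i (low k j l) x = 1/2 * (partial i (partial j (\<lambda>x. h x $ l $ k)) x
      + partial i (partial l (\<lambda>x. h x $ j $ k)) x - partial i (partial k (\<lambda>x. h x $ j $ l)) x)" for i j
    unfolding christoffel_low_def[abs_def]
    by (simp only: partial_rules smooth_facts x partial_const mult_zero_left add_0)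
  then show ?thesis
    unfolding riemann_low[OF x]
    by (simp add: sum_subtractf second_partials_metric_commute(1)[OF x, of i j])
qed

lemma riemann_antisym12: "riemann h j i k l x = - riemann h i j k l x"
  by (simp add: riemann_def riemann_up_def sum_negf[symmetric] sum_subtractf algebra_simps)

lemma riemann_pair:
  assumes x: "x \<in> \<Omega>"
  shows "riemann h k l i j x = riemann h i j k l x"
  using low_pairing_commute[OF x, of l i k j] low_commute[OF x] christoffel_commute[OF x]
    second_partials_metric_commute[OF x]
  unfolding riemann_second_partials[OF x] by simp

lemma riemann_antisym34:
  assumes x: "x \<in> \<Omega>"
  shows "riemann h i j l k x = - riemann h i j k l x"
  using riemann_pair[OF x] riemann_antisym12 by metis

lemma riemann_up_cyclic:
  assumes x: "x \<in> \<Omega>"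
  shows "riemann_up h k i j l x + riemann_up h k j l i x + riemann_up h k l i j x = 0"
proof -
  have "partial i (\<Gamma> k j l) x = partial i (\<Gamma> k l j) x" for i j l
    by (rule partial_cong[OF open_domain x]) (rule christoffel_commute)
  then show ?thesis
    unfolding riemann_up_def using christoffel_commute[OF x] by (simp add: sum_subtractf)
qed

lemma riemann_cyclic:
  assumes x: "x \<in> \<Omega>"
  shows "riemann h i j k l x + riemann h j l k i x + riemann h l i k j x = 0"
  unfolding riemann_def
  by (simp add: sum.distrib[symmetric] distrib_left[symmetric] riemann_up_cyclic[OF x])


section \<open>Covariant derivatives and the Ricci identity\<close>

lemma cov_deriv_lower_order:
  "cov_deriv h T [p, a, b] x = partial p (T [a, b]) x
     - (\<Sum>q\<in>UNIV. \<Gamma> q p a x * T [q, b] x + \<Gamma> q p b x * T [a, q] x)"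
  "cov_deriv h T [p, a, b, c] x = partial p (T [a, b, c]) x
     - (\<Sum>q\<in>UNIV. \<Gamma> q p a x * T [q, b, c] x + \<Gamma> q p b x * T [a, q, c] x + \<Gamma> q p c x * T [a, b, q] x)"
  "cov_deriv h T [p, a, b, c, d] x = partial p (T [a, b, c, d]) x
     - (\<Sum>q\<in>UNIV. \<Gamma> q p a x * T [q, b, c, d] x + \<Gamma> q p b x * T [a, q, c, d] x
         + \<Gamma> q p c x * T [a, b, q, d] x + \<Gamma> q p d x * T [a, b, c, q] x)"
  "cov_deriv h T [p, a, b, c, d, e] x = partial p (T [a, b, c, d, e]) x
     - (\<Sum>q\<in>UNIV. \<Gamma> q p a x * T [q, b, c, d, e] x + \<Gamma> q p b x * T [a, q, c, d, e] x
         + \<Gamma> q p c x * T [a, b, q, d, e] x + \<Gamma> q p d x * T [a, b, c, q, e] x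
         + \<Gamma> q p e x * T [a, b, c, d, q] x)"
  by (simp_all add: lessThan_Suc numeral_eq_Suc sum.distrib)

declare cov_deriv.simps(1) [simp del]

lemma smooth_cov_deriv:
  assumes "\<And>js'. length js' = length js \<Longrightarrow> smooth_on \<Omega> (T js')"
  shows "smooth_on \<Omega> (cov_deriv h T (p # js))"
  unfolding cov_deriv.simps(1)[abs_def]
  using assms by (intro smooth_facts smooth_on_sum[OF open_domain finite_lessThan]) simp_all

lemma cov_deriv_cong:
  assumes x: "x \<in> \<Omega>" and eq: "\<And>js' y. length js' = length js \<Longrightarrow> y \<in> \<Omega> \<Longrightarrow> S js' y = T js' y"
  shows "cov_deriv h S (p # js) x = cov_deriv h T (p # js) x"
  using partial_cong[OF open_domain x, of "S js" "T js" p] x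
  by (simp add: cov_deriv.simps(1) eq)

text \<open>In \<open>\<nabla>\<^sub>p\<nabla>\<^sub>qT - \<nabla>\<^sub>q\<nabla>\<^sub>pT\<close> the terms with a derivative of \<open>T\<close> cancel, because the connection is torsion
  free and the partial derivatives commute. Of the terms quadratic in \<open>\<Gamma>\<close>, those in which \<open>\<Gamma>\<close> acts on
  two different slots of \<open>T\<close> cancel as well; those acting twice on the same slot combine with the
  derivatives of \<open>\<Gamma>\<close> to the curvature.\<close>

lemma ricci_identity:
  assumes x: "x \<in> \<Omega>" and T: "\<And>js'. length js' = length js \<Longrightarrow> smooth_on \<Omega> (T js')"
  shows "cov_deriv h (cov_deriv h T) (p # q # js) x - cov_deriv h (cov_deriv h T) (q # p # js) x
    = - (\<Sum>m<length js. \<Sum>s\<in>UNIV. riemann_up h s p q (js ! m) x * T (js[m := s]) x)"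
proof -
  let ?n = "length js"
  \<comment> \<open>The connection acting first on slot \<open>m\<close>, in direction \<open>p\<close>, then on slot \<open>m'\<close>, in direction \<open>q\<close>.\<close>
  define Z where "Z p q m m' = (\<Sum>s\<in>UNIV. \<Sum>r\<in>UNIV.
      \<Gamma> s p (js ! m) x * \<Gamma> r q (js[m := s] ! m') x * T (js[m := s, m' := r]) x)" for p q m m'
  have expand: "cov_deriv h (cov_deriv h T) (p # q # js) x =
      partial p (partial q (T js)) x
      - (\<Sum>m<?n. \<Sum>s\<in>UNIV. partial p (\<Gamma> s q (js ! m)) x * T (js[m := s]) x)
      - (\<Sum>m<?n. \<Sum>s\<in>UNIV. \<Gamma> s q (js ! m) x * partial p (T (js[m := s])) x)
      - (\<Sum>s\<in>UNIV. \<Gamma> s p q x * cov_deriv h T (s # js) x)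
      - (\<Sum>m<?n. \<Sum>s\<in>UNIV. \<Gamma> s p (js ! m) x * partial q (T (js[m := s])) x)
      + (\<Sum>m<?n. \<Sum>m'<?n. Z p q m m')" for p q
  proof -
    have 1: "partial p (cov_deriv h T (q # js)) x = partial p (partial q (T js)) x
      - (\<Sum>m<?n. \<Sum>s\<in>UNIV. partial p (\<Gamma> s q (js ! m)) x * T (js[m := s]) x)
      - (\<Sum>m<?n. \<Sum>s\<in>UNIV. \<Gamma> s q (js ! m) x * partial p (T (js[m := s])) x)"
    proof -
      have sm: "smooth_on \<Omega> (\<lambda>x. \<Sum>s\<in>UNIV. \<Gamma> s q (js ! m) x * T (js[m := s]) x)" for m
        using T by (intro smooth_facts) simp
      have "partial p (cov_deriv h T (q # js)) x = partial p (partial q (T js)) x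
          - partial p (\<lambda>x. \<Sum>m<?n. \<Sum>s\<in>UNIV. \<Gamma> s q (js ! m) x * T (js[m := s]) x) x"
        unfolding cov_deriv.simps(1)[abs_def]
        using T by (intro partial_smooth_diff smooth_facts smooth_on_sum[OF open_domain finite_lessThan] x) simp_all
      also have "partial p (\<lambda>x. \<Sum>m<?n. \<Sum>s\<in>UNIV. \<Gamma> s q (js ! m) x * T (js[m := s]) x) x
         = (\<Sum>m<?n. partial p (\<lambda>x. \<Sum>s\<in>UNIV. \<Gamma> s q (js ! m) x * T (js[m := s]) x) x)"
        by (rule partial_sum) (simp_all add: smooth_at[OF sm x])
      also have "\<dots> = (\<Sum>m<?n. \<Sum>s\<in>UNIV. partial p (\<Gamma> s q (js ! m)) x * T (js[m := s]) x
          + \<Gamma> s q (js ! m) x * partial p (T (js[m := s])) x)"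
        using T by (simp add: partial_rules smooth_facts x)
      finally show ?thesis by (simp add: sum.distrib)
    qed
    \<comment> \<open>The new slot \<open>q\<close> of \<open>\<nabla>T\<close> is split off; it gives the terms that cancel by symmetry of \<open>\<Gamma>\<close>.\<close>
    have len: "{..<length (q # js)} = insert 0 (Suc ` {..<?n})"
      by (simp add: lessThan_Suc_eq_insert_0)
    have 2: "(\<Sum>m<length (q # js). \<Sum>s\<in>UNIV. \<Gamma> s p ((q # js) ! m) x * cov_deriv h T ((q # js)[m := s]) x)
       = (\<Sum>s\<in>UNIV. \<Gamma> s p q x * cov_deriv h T (s # js) x)
         + (\<Sum>m<?n. \<Sum>s\<in>UNIV. \<Gamma> s p (js ! m) x * cov_deriv h T (q # js[m := s]) x)"
      unfolding len by (simp add: sum.reindex)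
    have 3: "(\<Sum>m<?n. \<Sum>s\<in>UNIV. \<Gamma> s p (js ! m) x * cov_deriv h T (q # js[m := s]) x)
      = (\<Sum>m<?n. \<Sum>s\<in>UNIV. \<Gamma> s p (js ! m) x * partial q (T (js[m := s])) x)
        - (\<Sum>m<?n. \<Sum>m'<?n. Z p q m m')"
      unfolding Z_def cov_deriv.simps(1) sum_subtractf[symmetric]
      by (intro sum.cong refl, subst sum.swap)
         (simp add: right_diff_distrib sum_subtractf sum_distrib_left mult.assoc)
    show ?thesis
      unfolding cov_deriv.simps(1)[of h "cov_deriv h T"] 1 2 3 by simp
  qed
  have Zsum: "(\<Sum>m<?n. \<Sum>m'<?n. Z p q m m') - (\<Sum>m<?n. \<Sum>m'<?n. Z q p m m')
     = (\<Sum>m<?n. Z p q m m - Z q p m m)"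
  proof -
    have off: "Z p q m m' = Z q p m' m" if "m \<noteq> m'" "m < ?n" "m' < ?n" for m m'
      unfolding Z_def
      by (subst sum.swap) (use that in \<open>simp add: list_update_swap mult_ac\<close>)
    have "(\<Sum>m<?n. \<Sum>m'<?n. Z p q m m') - (\<Sum>m<?n. \<Sum>m'<?n. Z q p m m')
       = (\<Sum>m<?n. \<Sum>m'<?n. Z p q m m' - Z q p m' m)"
      by (subst (2) sum.swap) (simp add: sum_subtractf)
    also have "\<dots> = (\<Sum>m<?n. \<Sum>m'<?n. if m = m' then Z p q m m - Z q p m m else 0)"
      by (intro sum.cong refl) (auto simp: off)
    finally show ?thesis by simp
  qed
  have Zdiag: "Z p q m m = (\<Sum>r\<in>UNIV. (\<Sum>s\<in>UNIV. \<Gamma> r q s x * \<Gamma> s p (js ! m) x) * T (js[m := r]) x)"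
    if "m < ?n" for p q m
    unfolding Z_def sum_distrib_right by (subst sum.swap) (use that in \<open>simp add: mult_ac\<close>)
  have "(\<Sum>m<?n. \<Sum>s\<in>UNIV. riemann_up h s p q (js ! m) x * T (js[m := s]) x)
    = (\<Sum>m<?n. \<Sum>s\<in>UNIV. partial p (\<Gamma> s q (js ! m)) x * T (js[m := s]) x)
     - (\<Sum>m<?n. \<Sum>s\<in>UNIV. partial q (\<Gamma> s p (js ! m)) x * T (js[m := s]) x)
     - (\<Sum>m<?n. Z p q m m - Z q p m m)"
  proof -
    have "(\<Sum>m<?n. Z p q m m - Z q p m m) = (\<Sum>m<?n. \<Sum>r\<in>UNIV.
        (\<Sum>s\<in>UNIV. \<Gamma> r q s x * \<Gamma> s p (js ! m) x) * T (js[m := r]) x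
        - (\<Sum>s\<in>UNIV. \<Gamma> r p s x * \<Gamma> s q (js ! m) x) * T (js[m := r]) x)"
      by (intro sum.cong refl) (simp add: Zdiag sum_subtractf)
    then show ?thesis
      by (simp add: riemann_up_def sum_subtractf[symmetric] algebra_simps)
         (simp add: sum_subtractf sum.distrib algebra_simps)
  qed
  moreover have "(\<Sum>s\<in>UNIV. \<Gamma> s p q x * cov_deriv h T (s # js) x) =
      (\<Sum>s\<in>UNIV. \<Gamma> s q p x * cov_deriv h T (s # js) x)"
    by (simp add: christoffel_commute[OF x, of _ q p])
  moreover have "partial p (partial q (T js)) x = partial q (partial p (T js)) x"
    using partial_commute[OF open_domain x] T by blast
  ultimately show ?thesis
    unfolding expand[of p q] expand[of q p] using Zsum by linarith
qed

section \<open>The second Bianchi identity\<close>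

text \<open>The second Bianchi identity \<open>dF + [A,F] = 0\<close> for the curvature \<open>F = dA + [A,A]\<close> of a matrix-valued
  connection form. Here \<open>D i j\<close> stands for \<open>\<partial>\<^sub>iA\<^sub>j\<close>, and \<open>dQ\<close> is the derivative of the quadratic part of
  \<open>F\<close>; the second derivatives of \<open>A\<close> drop out of the cyclic sum by symmetry. What is left is the
  Jacobi identity.\<close>

lemma matrix_bianchi:
  fixes A :: "'i \<Rightarrow> real^'n^'n" and D :: "'i \<Rightarrow> 'i \<Rightarrow> real^'n^'n"
  defines "F \<equiv> \<lambda>i j. D i j - D j i + A i ** A j - A j ** A i"
    and "dQ \<equiv> \<lambda>p i j. D p i ** A j + A i ** D p j - D p j ** A i - A j ** D p i"
  shows "(dQ p i j + A p ** F i j - F i j ** A p) + (dQ i j p + A i ** F j p - F j p ** A i)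
    + (dQ j p i + A j ** F p i - F p i ** A j) = 0"
proof -
  have distribs: "X ** (Y - Z) = X ** Y - X ** Z" "(Y - Z) ** X = Y ** X - Z ** X" "(Y + Z) ** X = Y ** X + Z ** X"
    for X Y Z :: "real^'n^'n"
    by (simp_all add: matrix_matrix_mult_def vec_eq_iff algebra_simps sum_subtractf sum.distrib)
  show ?thesis
    by (simp add: F_def dQ_def distribs matrix_add_ldistrib matrix_mul_assoc)
qed


abbreviation Rm :: "'n list \<Rightarrow> real^'n \<Rightarrow> real" where "Rm \<equiv> riemann_tensor h"
abbreviation DRm :: "'n list \<Rightarrow> real^'n \<Rightarrow> real" where "DRm \<equiv> cov_deriv h Rm"
abbreviation DDRm :: "'n list \<Rightarrow> real^'n \<Rightarrow> real" where "DDRm \<equiv> cov_deriv h DRm"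

lemma riemann_tensor_list [simp]: "Rm [i, j, k, l] = riemann h i j k l"
  by (simp add: riemann_tensor_def fun_eq_iff)

lemma smooth_riemann_tensor: "smooth_on \<Omega> (Rm js)"
  unfolding riemann_tensor_def by (rule smooth_riemann)

lemma smooth_DRm: "smooth_on \<Omega> (DRm (p # js))"
  by (rule smooth_cov_deriv) (rule smooth_riemann_tensor)

text \<open>\<open>\<nabla>\<^sub>pR\<^sup>s\<^sub>i\<^sub>j\<^sub>l\<close>, needed separately because \<open>cov_deriv\<close> covers covariant tensors only.\<close>

definition cov_deriv_riemann_up :: "'n \<Rightarrow> 'n \<Rightarrow> 'n \<Rightarrow> 'n \<Rightarrow> 'n \<Rightarrow> real^'n \<Rightarrow> real" where
  "cov_deriv_riemann_up p s i j l x = partial p (riemann_up h s i j l) x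
     + (\<Sum>m\<in>UNIV. \<Gamma> s p m x * riemann_up h m i j l x - \<Gamma> m p i x * riemann_up h s m j l x
         - \<Gamma> m p j x * riemann_up h s i m l x - \<Gamma> m p l x * riemann_up h s i j m x)"

lemma riemann_up_antisym: "riemann_up h s j i l x = - riemann_up h s i j l x"
  by (simp add: riemann_up_def sum_subtractf)

text \<open>In the indices \<open>s, l\<close> the curvature is that of the matrices \<open>A\<^sub>i = (\<Gamma>\<^sup>s\<^sub>i\<^sub>l)\<close>, so that
  \<open>matrix_bianchi\<close> applies. The terms \<open>U\<close>, which come from the indices \<open>i, j\<close>, cancel in the cyclic
  sum as \<open>\<Gamma>\<close> is symmetric and the curvature antisymmetric.\<close>

lemma second_bianchi_up:
  assumes x: "x \<in> \<Omega>"
  shows "cov_deriv_riemann_up p s i j l x + cov_deriv_riemann_up i s j p l x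
    + cov_deriv_riemann_up j s p i l x = 0"
proof -
  define A :: "'n \<Rightarrow> real^'n^'n" where "A i = (\<chi> s l. \<Gamma> s i l x)" for i
  define D :: "'n \<Rightarrow> 'n \<Rightarrow> real^'n^'n" where "D i j = (\<chi> s l. partial i (\<Gamma> s j l) x)" for i j
  define F where "F i j = D i j - D j i + A i ** A j - A j ** A i" for i j
  define dQ where "dQ p i j = D p i ** A j + A i ** D p j - D p j ** A i - A j ** D p i" for p i j
  define DD where "DD p i j = partial p (partial i (\<Gamma> s j l)) x" for p i j
  define U where "U p i j = (\<Sum>m\<in>UNIV. \<Gamma> m p i x * riemann_up h s m j l x)" for p i j
  have F: "F i j $ s $ l = riemann_up h s i j l x" for i j s l
    by (simp add: F_def A_def D_def riemann_up_def matrix_matrix_mult_def sum_subtractf)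
  have dR: "partial p (riemann_up h s i j l) x = DD p i j - DD p j i + dQ p i j $ s $ l" for p i j
    unfolding riemann_up_def[abs_def] DD_def
    by (simp add: partial_rules smooth_facts x dQ_def A_def D_def matrix_matrix_mult_def
        sum_subtractf sum.distrib algebra_simps)
  have expand: "cov_deriv_riemann_up p s i j l x =
     DD p i j - DD p j i + (dQ p i j + A p ** F i j - F i j ** A p) $ s $ l - U p i j + U p j i" for p i j
  proof -
    have "(\<Sum>m\<in>UNIV. \<Gamma> m p j x * riemann_up h s i m l x) = - U p j i"
      unfolding U_def by (subst riemann_up_antisym) (simp add: sum_negf)
    moreover have "(A p ** F i j) $ s $ l = (\<Sum>m\<in>UNIV. \<Gamma> s p m x * riemann_up h m i j l x)"
      "(F i j ** A p) $ s $ l = (\<Sum>m\<in>UNIV. \<Gamma> m p l x * riemann_up h s i j m x)"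
      by (simp_all add: matrix_matrix_mult_def F A_def mult.commute)
    ultimately show ?thesis
      by (simp add: cov_deriv_riemann_up_def dR sum_subtractf sum.distrib U_def)
  qed
  have "(dQ p i j + A p ** F i j - F i j ** A p) + (dQ i j p + A i ** F j p - F j p ** A i)
    + (dQ j p i + A j ** F p i - F p i ** A j) = 0"
    unfolding F_def dQ_def by (rule matrix_bianchi)
  then have "((dQ p i j + A p ** F i j - F i j ** A p) + (dQ i j p + A i ** F j p - F j p ** A i)
    + (dQ j p i + A j ** F p i - F p i ** A j)) $ s $ l = 0"
    by simp
  moreover have "DD p i j = DD i p j" for p i j
    unfolding DD_def by (rule partial_commute[OF open_domain x smooth_christoffel])
  then have "DD p i j = DD i p j" "DD i j p = DD j i p" "DD j p i = DD p j i" by auto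
  moreover have "U p i j = U i p j" for p i j
    by (simp add: U_def christoffel_commute[OF x, of _ p i])
  then have "U p i j = U i p j" "U i j p = U j i p" "U j p i = U p j i" by auto
  ultimately show ?thesis unfolding expand by simp
qed

text \<open>Lowering an index commutes with \<open>\<nabla>\<close>, because \<open>\<nabla>g = 0\<close>.\<close>

lemma cov_deriv_riemann_lower:
  assumes x: "x \<in> \<Omega>"
  shows "DRm [p, i, j, k, l] x = (\<Sum>s\<in>UNIV. h x $ k $ s * cov_deriv_riemann_up p s i j l x)"
proof -
  have d: "partial p (riemann h i j k l) x = (\<Sum>s\<in>UNIV. (\<Sum>m\<in>UNIV. h x $ s $ m * \<Gamma> m p k x + h x $ k $ m * \<Gamma> m p s x)
      * riemann_up h s i j l x + h x $ k $ s * partial p (riemann_up h s i j l) x)"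
    unfolding riemann_def[abs_def]
    by (simp add: partial_rules smooth_facts smooth_riemann_up x partial_metric[OF x])
  have 1: "(\<Sum>s\<in>UNIV. \<Sum>m\<in>UNIV. h x $ s $ m * \<Gamma> m p k x * riemann_up h s i j l x)
      = (\<Sum>m\<in>UNIV. \<Gamma> m p k x * riemann h i j m l x)"
    unfolding riemann_def sum_distrib_left
    by (subst sum.swap, intro sum.cong refl) (simp add: mult_ac, metis metric_commute[OF x])
  have 2: "(\<Sum>s\<in>UNIV. \<Sum>m\<in>UNIV. h x $ k $ m * \<Gamma> m p s x * riemann_up h s i j l x)
      = (\<Sum>m\<in>UNIV. h x $ k $ m * (\<Sum>s\<in>UNIV. \<Gamma> m p s x * riemann_up h s i j l x))"
    unfolding sum_distrib_left by (subst sum.swap) (simp add: mult_ac)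
  have 3: "(\<Sum>q\<in>UNIV. \<Gamma> q p a x * riemann h (f q) (g q) k (e q) x)
      = (\<Sum>s\<in>UNIV. h x $ k $ s * (\<Sum>q\<in>UNIV. \<Gamma> q p a x * riemann_up h s (f q) (g q) (e q) x))" for a f g e
    unfolding riemann_def sum_distrib_left by (subst sum.swap) (simp add: mult_ac)
  show ?thesis
    unfolding cov_deriv_lower_order riemann_tensor_list d cov_deriv_riemann_up_def
    by (simp add: sum.distrib sum_subtractf distrib_left distrib_right right_diff_distrib
        sum_distrib_right 1 2 3[of i "\<lambda>q. q"] 3[of j "\<lambda>_. i" "\<lambda>q. q"] 3[of l "\<lambda>_. i" "\<lambda>_. j" "\<lambda>q. q"])
qed

lemma second_bianchi:
  assumes x: "x \<in> \<Omega>"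
  shows "DRm [p, i, j, k, l] x + DRm [i, j, p, k, l] x + DRm [j, p, i, k, l] x = 0"
  unfolding cov_deriv_riemann_lower[OF x]
  by (simp add: sum.distrib[symmetric] distrib_left[symmetric] second_bianchi_up[OF x])

lemma DRm_antisym12:
  assumes x: "x \<in> \<Omega>"
  shows "DRm [p, j, i, k, l] x = - DRm [p, i, j, k, l] x"
proof -
  have "partial p (riemann h j i k l) x = partial p (\<lambda>x. - riemann h i j k l x) x"
    by (rule partial_cong[OF open_domain x]) (rule riemann_antisym12)
  then show ?thesis
    by (simp add: cov_deriv_lower_order partial_smooth_uminus smooth_riemann x sum.distrib sum_negf sum_subtractf
        riemann_antisym12[of j i] riemann_antisym12[of _ i] riemann_antisym12[of j])
qed

lemma DRm_pair:
  assumes x: "x \<in> \<Omega>"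
  shows "DRm [p, k, l, i, j] x = DRm [p, i, j, k, l] x"
proof -
  have "partial p (riemann h k l i j) x = partial p (riemann h i j k l) x"
    by (rule partial_cong[OF open_domain x]) (rule riemann_pair)
  then show ?thesis
    by (simp add: cov_deriv_lower_order riemann_pair[OF x, of _ l i j] riemann_pair[OF x, of k _ i j]
       riemann_pair[OF x, of k l _ j] riemann_pair[OF x, of k l i _] add_ac)
qed

lemma DRm_antisym34:
  assumes x: "x \<in> \<Omega>"
  shows "DRm [p, i, j, l, k] x = - DRm [p, i, j, k, l] x"
  using DRm_pair[OF x] DRm_antisym12[OF x] by metis

lemma DDRm_antisym12:
  assumes x: "x \<in> \<Omega>"
  shows "DDRm [q, p, j, i, k, l] x = - DDRm [q, p, i, j, k, l] x"
proof -
  have "partial q (DRm [p, j, i, k, l]) x = partial q (\<lambda>x. - DRm [p, i, j, k, l] x) x"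
    by (rule partial_cong[OF open_domain x]) (rule DRm_antisym12)
  then show ?thesis
    unfolding cov_deriv_lower_order(4)[of DRm]
    by (simp add: partial_smooth_uminus smooth_DRm x sum_negf sum.distrib sum_subtractf
        DRm_antisym12[OF x, of _ j i] DRm_antisym12[OF x, of _ j] DRm_antisym12[OF x, of _ _ i])
qed

lemma DDRm_bianchi:
  assumes x: "x \<in> \<Omega>"
  shows "DDRm [q, p, i, j, k, l] x + DDRm [q, i, j, p, k, l] x + DDRm [q, j, p, i, k, l] x = 0"
proof -
  let ?S = "\<lambda>p i j k l x. DRm [p, i, j, k, l] x + DRm [i, j, p, k, l] x + DRm [j, p, i, k, l] x"
  have "partial q (DRm [p, i, j, k, l]) x + partial q (DRm [i, j, p, k, l]) x + partial q (DRm [j, p, i, k, l]) x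
      = partial q (?S p i j k l) x"
    by (simp only: partial_rules smooth_facts smooth_DRm x)
  also have "\<dots> = partial q (\<lambda>x. 0) x"
    by (rule partial_cong[OF open_domain x]) (rule second_bianchi)
  finally have d: "partial q (DRm [p, i, j, k, l]) x + partial q (DRm [i, j, p, k, l]) x + partial q (DRm [j, p, i, k, l]) x = 0"
    by simp
  have "DDRm [q, p, i, j, k, l] x + DDRm [q, i, j, p, k, l] x + DDRm [q, j, p, i, k, l] x
    = (partial q (DRm [p, i, j, k, l]) x + partial q (DRm [i, j, p, k, l]) x + partial q (DRm [j, p, i, k, l]) x)
      - (\<Sum>m\<in>UNIV. \<Gamma> m q p x * ?S m i j k l x + \<Gamma> m q i x * ?S p m j k l x + \<Gamma> m q j x * ?S p i m k l x
          + \<Gamma> m q k x * ?S p i j m l x + \<Gamma> m q l x * ?S p i j k m x)"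
    unfolding cov_deriv_lower_order(4)[of DRm]
    by (simp add: sum.distrib distrib_left)
  then show ?thesis unfolding d second_bianchi[OF x] by simp
qed

section \<open>Contraction\<close>

text \<open>This is \<open>\<nabla>g\<^sup>-\<^sup>1 = 0\<close> written out. It follows by differentiating \<open>g\<^sup>-\<^sup>1 g = 1\<close>.\<close>

lemma partial_inverse_metric:
  assumes x: "x \<in> \<Omega>"
  shows "partial p (G i n) x = - (\<Sum>q\<in>UNIV. G q n x * \<Gamma> i p q x + G i q x * \<Gamma> n p q x)"
proof -
  have z: "(\<Sum>q\<in>UNIV. partial p (G i q) x * h x $ q $ j)
     = - (\<Sum>q\<in>UNIV. G i q x * partial p (\<lambda>x. h x $ q $ j) x)" for j
  proof -
    have "(\<Sum>q\<in>UNIV. partial p (G i q) x * h x $ q $ j) + (\<Sum>q\<in>UNIV. G i q x * partial p (\<lambda>x. h x $ q $ j) x)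
      = partial p (\<lambda>x. \<Sum>q\<in>UNIV. G i q x * h x $ q $ j) x"
      by (simp add: partial_rules smooth_facts x sum.distrib)
    also have "\<dots> = partial p (\<lambda>x. if i = j then 1 else 0) x"
      by (rule partial_cong[OF open_domain x]) (rule inverse_metric)
    finally show ?thesis by simp
  qed
  \<comment> \<open>Multiplication by \<open>g\<close> and then by its inverse, to solve for the derivative of the inverse.\<close>
  have collapse: "(\<Sum>j\<in>UNIV. (\<Sum>q\<in>UNIV. a q * h x $ q $ j) * G j n x) = a n" for a n
  proof -
    have "(\<Sum>j\<in>UNIV. (\<Sum>q\<in>UNIV. a q * h x $ q $ j) * G j n x)
       = (\<Sum>q\<in>UNIV. a q * (\<Sum>j\<in>UNIV. h x $ q $ j * G j n x))"
      unfolding sum_distrib_right sum_distrib_left by (subst sum.swap) (simp add: mult_ac)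
    then show ?thesis
      by (simp add: metric_inverse[OF x] if_distrib[of "\<lambda>z. a _ * z"] cong: if_cong)
  qed
  have dh: "(\<Sum>q\<in>UNIV. G i q x * partial p (\<lambda>x. h x $ q $ j) x)
     = (\<Sum>m\<in>UNIV. (\<Sum>q\<in>UNIV. G i q x * \<Gamma> m p q x) * h x $ m $ j) + \<Gamma> i p j x" for j
  proof -
    have "(\<Sum>q\<in>UNIV. G i q x * partial p (\<lambda>x. h x $ q $ j) x)
      = (\<Sum>q\<in>UNIV. \<Sum>m\<in>UNIV. G i q x * (h x $ j $ m * \<Gamma> m p q x))
        + (\<Sum>q\<in>UNIV. \<Sum>m\<in>UNIV. G i q x * h x $ q $ m * \<Gamma> m p j x)"
      by (simp add: partial_metric[OF x] sum.distrib sum_distrib_left distrib_left mult.assoc)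
    also have "(\<Sum>q\<in>UNIV. \<Sum>m\<in>UNIV. G i q x * h x $ q $ m * \<Gamma> m p j x) = \<Gamma> i p j x"
      by (subst sum.swap) (simp add: sum_distrib_right[symmetric] inverse_metric[OF x]
          if_distrib[of "\<lambda>a. a * _"] cong: if_cong)
    also have "(\<Sum>q\<in>UNIV. \<Sum>m\<in>UNIV. G i q x * (h x $ j $ m * \<Gamma> m p q x))
      = (\<Sum>m\<in>UNIV. (\<Sum>q\<in>UNIV. G i q x * \<Gamma> m p q x) * h x $ m $ j)"
      unfolding sum_distrib_right
      by (subst sum.swap) (simp add: mult_ac metric_commute[OF x, of j])
    finally show ?thesis .
  qed
  have "partial p (G i n) x = (\<Sum>j\<in>UNIV. (\<Sum>q\<in>UNIV. partial p (G i q) x * h x $ q $ j) * G j n x)"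
    by (simp add: collapse)
  also have "\<dots> = - (\<Sum>q\<in>UNIV. G i q x * \<Gamma> n p q x) - (\<Sum>j\<in>UNIV. \<Gamma> i p j x * G j n x)"
    unfolding z dh mult_minus_left sum_negf distrib_right sum.distrib collapse by simp
  finally show ?thesis by (simp add: sum.distrib mult.commute)
qed

text \<open>Contraction commutes with \<open>\<nabla>\<close>: the derivative of \<open>g\<^sup>m\<^sup>n\<close> supplies exactly the connection terms of the
  two slots that are summed over. Contractions of other slots are reduced to this case by permuting
  the arguments of \<open>T\<close>.\<close>

lemma cov_deriv_contraction:
  assumes x: "x \<in> \<Omega>" and T: "\<And>js'. length js' = Suc (Suc (length js)) \<Longrightarrow> smooth_on \<Omega> (T js')"
  shows "cov_deriv h (\<lambda>js x. \<Sum>m\<in>UNIV. \<Sum>n\<in>UNIV. G m n x * T (m # n # js) x) (p # js) x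
    = (\<Sum>m\<in>UNIV. \<Sum>n\<in>UNIV. G m n x * cov_deriv h T (p # m # n # js) x)"
proof -
  let ?C = "\<lambda>js x. \<Sum>m\<in>UNIV. \<Sum>n\<in>UNIV. G m n x * T (m # n # js) x"
  have d: "partial p (?C js) x = (\<Sum>m\<in>UNIV. \<Sum>n\<in>UNIV. partial p (G m n) x * T (m # n # js) x)
      + (\<Sum>m\<in>UNIV. \<Sum>n\<in>UNIV. G m n x * partial p (T (m # n # js)) x)"
    using T by (simp add: partial_rules smooth_facts x sum.distrib)
  have dG: "(\<Sum>m\<in>UNIV. \<Sum>n\<in>UNIV. partial p (G m n) x * T (m # n # js) x)
     = - (\<Sum>m\<in>UNIV. \<Sum>n\<in>UNIV. G m n x * (\<Sum>q\<in>UNIV. \<Gamma> q p m x * T (q # n # js) x))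
       - (\<Sum>m\<in>UNIV. \<Sum>n\<in>UNIV. G m n x * (\<Sum>q\<in>UNIV. \<Gamma> q p n x * T (m # q # js) x))"
  proof -
    have "(\<Sum>m\<in>UNIV. \<Sum>n\<in>UNIV. partial p (G m n) x * T (m # n # js) x)
      = - (\<Sum>m\<in>UNIV. \<Sum>n\<in>UNIV. \<Sum>q\<in>UNIV. G q n x * \<Gamma> m p q x * T (m # n # js) x)
        - (\<Sum>m\<in>UNIV. \<Sum>n\<in>UNIV. \<Sum>q\<in>UNIV. G m q x * \<Gamma> n p q x * T (m # n # js) x)"
      by (simp add: partial_inverse_metric[OF x] sum.distrib sum_distrib_right sum_negf sum_subtractf
          distrib_right left_diff_distrib)
    also have "(\<Sum>m\<in>UNIV. \<Sum>n\<in>UNIV. \<Sum>q\<in>UNIV. G m q x * \<Gamma> n p q x * T (m # n # js) x)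
      = (\<Sum>m\<in>UNIV. \<Sum>n\<in>UNIV. G m n x * (\<Sum>q\<in>UNIV. \<Gamma> q p n x * T (m # q # js) x))"
      unfolding sum_distrib_left by (rule sum.cong[OF refl], subst sum.swap) (simp add: mult_ac)
    also have "(\<Sum>m\<in>UNIV. \<Sum>n\<in>UNIV. \<Sum>q\<in>UNIV. G q n x * \<Gamma> m p q x * T (m # n # js) x)
      = (\<Sum>n\<in>UNIV. \<Sum>m\<in>UNIV. \<Sum>q\<in>UNIV. G q n x * \<Gamma> m p q x * T (m # n # js) x)"
      by (rule sum.swap)
    also have "\<dots> = (\<Sum>n\<in>UNIV. \<Sum>m\<in>UNIV. G m n x * (\<Sum>q\<in>UNIV. \<Gamma> q p m x * T (q # n # js) x))"
      unfolding sum_distrib_left by (rule sum.cong[OF refl], subst sum.swap) (simp add: mult_ac)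
    also have "\<dots> = (\<Sum>m\<in>UNIV. \<Sum>n\<in>UNIV. G m n x * (\<Sum>q\<in>UNIV. \<Gamma> q p m x * T (q # n # js) x))"
      by (rule sum.swap)
    finally show ?thesis .
  qed
  have conn: "(\<Sum>r<length js. \<Sum>q\<in>UNIV. \<Gamma> q p (js ! r) x * ?C (js[r := q]) x)
     = (\<Sum>m\<in>UNIV. \<Sum>n\<in>UNIV. G m n x *
         (\<Sum>r<length js. \<Sum>q\<in>UNIV. \<Gamma> q p (js ! r) x * T (m # n # js[r := q]) x))"
  proof -
    have "(\<Sum>r<length js. \<Sum>q\<in>UNIV. \<Gamma> q p (js ! r) x * ?C (js[r := q]) x)
      = (\<Sum>r<length js. \<Sum>q\<in>UNIV. \<Sum>m\<in>UNIV. \<Sum>n\<in>UNIV. G m n x * (\<Gamma> q p (js ! r) x * T (m # n # js[r := q]) x))"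
      by (simp add: sum_distrib_left mult_ac)
    also have "\<dots> = (\<Sum>r<length js. \<Sum>m\<in>UNIV. \<Sum>q\<in>UNIV. \<Sum>n\<in>UNIV. G m n x * (\<Gamma> q p (js ! r) x * T (m # n # js[r := q]) x))"
      by (rule sum.cong[OF refl]) (rule sum.swap)
    also have "\<dots> = (\<Sum>m\<in>UNIV. \<Sum>r<length js. \<Sum>q\<in>UNIV. \<Sum>n\<in>UNIV. G m n x * (\<Gamma> q p (js ! r) x * T (m # n # js[r := q]) x))"
      by (rule sum.swap)
    also have "\<dots> = (\<Sum>m\<in>UNIV. \<Sum>r<length js. \<Sum>n\<in>UNIV. \<Sum>q\<in>UNIV. G m n x * (\<Gamma> q p (js ! r) x * T (m # n # js[r := q]) x))"
      by (rule sum.cong[OF refl], rule sum.cong[OF refl]) (rule sum.swap)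
    also have "\<dots> = (\<Sum>m\<in>UNIV. \<Sum>n\<in>UNIV. \<Sum>r<length js. \<Sum>q\<in>UNIV. G m n x * (\<Gamma> q p (js ! r) x * T (m # n # js[r := q]) x))"
      by (rule sum.cong[OF refl]) (rule sum.swap)
    finally show ?thesis by (simp add: sum_distrib_left)
  qed
  show ?thesis
    unfolding cov_deriv.simps(1)[of h ?C] d dG conn
    by (simp add: cov_deriv.simps(1) sum.lessThan_Suc_shift right_diff_distrib distrib_left
        sum.distrib sum_subtractf del: sum.lessThan_Suc)
qed

end


section \<open>The linearized curvature tensor\<close>

text \<open>The derivative of \<open>R\<^sub>i\<^sub>j\<^sub>k\<^sub>l\<close> at the metric \<open>h\<close> in the direction \<open>w\<close>. The quadratic part of \<open>riemann_low\<close>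
  is a form \<open>a\<cdot>h\<^sup>-\<^sup>1b\<close> in lowered Christoffel symbols, and varying \<open>h\<^sup>-\<^sup>1\<close> yields the last sum.\<close>

definition riemann_variation ::
    "(real^'n::finite \<Rightarrow> real^'n^'n) \<Rightarrow> ('n \<Rightarrow> 'n \<Rightarrow> real^'n \<Rightarrow> real) \<Rightarrow>
     'n \<Rightarrow> 'n \<Rightarrow> 'n \<Rightarrow> 'n \<Rightarrow> real^'n \<Rightarrow> real" where
  "riemann_variation h w i j k l x =
     partial i (christoffel_low w k j l) x - partial j (christoffel_low w k i l) x
     + (\<Sum>p\<in>UNIV. christoffel_low w p j k x * christoffel h p i l x
         + christoffel h p j k x * christoffel_low w p i l x
         - christoffel_low w p i k x * christoffel h p j l x
         - christoffel h p i k x * christoffel_low w p j l x)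
     - (\<Sum>p\<in>UNIV. \<Sum>q\<in>UNIV. w p q x *
         (christoffel h p j k x * christoffel h q i l x - christoffel h p i k x * christoffel h q j l x))"

context metric_on
begin

text \<open>The tensor \<open>c\<^sub>k\<^sub>i\<^sub>j = (\<nabla>\<^sub>iw\<^sub>j\<^sub>k + \<nabla>\<^sub>jw\<^sub>i\<^sub>k - \<nabla>\<^sub>kw\<^sub>i\<^sub>j)/2\<close> is the variation of the connection with its upper
  index lowered. The variation of \<open>R\<^sup>p\<^sub>i\<^sub>j\<^sub>l\<close> is the antisymmetrized covariant derivative of that of the
  connection, which accounts for \<open>E i j - E j i\<close>; lowering the index of the curvature contributes
  \<open>w\<^sub>k\<^sub>p R\<^sup>p\<^sub>i\<^sub>j\<^sub>l\<close>.\<close>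

lemma riemann_variation_covariant:
  fixes w :: "'n \<Rightarrow> 'n \<Rightarrow> real^'n \<Rightarrow> real"
  assumes x: "x \<in> \<Omega>" and smooth_w: "\<And>i j. smooth_on \<Omega> (w i j)"
    and w_commute: "\<And>i j y. y \<in> \<Omega> \<Longrightarrow> w i j y = w j i y"
  defines "W \<equiv> \<lambda>js. w (js ! 0) (js ! 1)"
  defines "DD \<equiv> cov_deriv h (cov_deriv h W)"
  shows "riemann_variation h w i j k l x =
     1/2 * (DD [i, j, l, k] x + DD [i, l, j, k] x - DD [i, k, j, l] x
          - DD [j, i, l, k] x - DD [j, l, i, k] x + DD [j, k, i, l] x)
     + (\<Sum>p\<in>UNIV. w k p x * riemann_up h p i j l x)"
proof -
  define c where "c k i j x = christoffel_low w k i j x - (\<Sum>p\<in>UNIV. w k p x * \<Gamma> p i j x)" for k i j x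
  define E where "E i j = partial i (c k j l) x
    - (\<Sum>q\<in>UNIV. \<Gamma> q i k x * c q j l x + \<Gamma> q i j x * c k q l x + \<Gamma> q i l x * c k j q x)" for i j
  let ?cl = "christoffel_low w"
  let ?DW = "cov_deriv h W"
  have smooth_cl: "smooth_on \<Omega> (?cl k i j)" for k i j
    unfolding christoffel_low_def[abs_def] by (intro smooth_rules smooth_w)
  have smooth_DW: "smooth_on \<Omega> (?DW (p # js))" for p js
    by (rule smooth_cov_deriv) (simp add: W_def smooth_w)
  have dw_commute: "partial i (w j k) y = partial i (w k j) y" if "y \<in> \<Omega>" for i j k y
    by (rule partial_cong[OF open_domain that]) (rule w_commute)
  have cl_commute: "?cl k i j y = ?cl k j i y" if "y \<in> \<Omega>" for k i j y
    using dw_commute[OF that] by (simp add: christoffel_low_def)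
  have dw: "partial i (w k p) x = ?cl k i p x + ?cl p i k x" for i k p
    using dw_commute[OF x] by (simp add: christoffel_low_def field_simps)
  have variation: "riemann_variation h w i j k l x = E i j - E j i + (\<Sum>p\<in>UNIV. w k p x * riemann_up h p i j l x)"
  proof -
    have dc: "partial i (c k j l) x = partial i (?cl k j l) x
       - (\<Sum>p\<in>UNIV. (?cl k i p x + ?cl p i k x) * \<Gamma> p j l x) - (\<Sum>p\<in>UNIV. w k p x * partial i (\<Gamma> p j l) x)" for i j
      unfolding c_def[abs_def]
      by (simp add: partial_rules smooth_facts smooth_w smooth_cl x dw sum.distrib)
    have ck: "(\<Sum>q\<in>UNIV. \<Gamma> q i l x * c k j q x) = (\<Sum>q\<in>UNIV. \<Gamma> q i l x * ?cl k j q x)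
       - (\<Sum>p\<in>UNIV. w k p x * (\<Sum>q\<in>UNIV. \<Gamma> p j q x * \<Gamma> q i l x))" for i j
      unfolding c_def right_diff_distrib sum_subtractf sum_distrib_left
      by (intro arg_cong2[where f = minus] refl, subst sum.swap) (simp add: mult_ac)
    have cq: "(\<Sum>q\<in>UNIV. \<Gamma> q i k x * c q j l x) = (\<Sum>q\<in>UNIV. \<Gamma> q i k x * ?cl q j l x)
       - (\<Sum>p\<in>UNIV. \<Sum>q\<in>UNIV. w p q x * (\<Gamma> p i k x * \<Gamma> q j l x))" for i j
      unfolding c_def right_diff_distrib sum_subtractf sum_distrib_left
      by (simp add: mult_ac)
    have sym: "(\<Sum>q\<in>UNIV. \<Gamma> q i j x * c k q l x) = (\<Sum>q\<in>UNIV. \<Gamma> q j i x * c k q l x)"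
      by (simp add: christoffel_commute[OF x, of _ j i])
    have E: "E i j = partial i (?cl k j l) x
       - (\<Sum>p\<in>UNIV. ?cl k i p x * \<Gamma> p j l x) - (\<Sum>p\<in>UNIV. ?cl p i k x * \<Gamma> p j l x)
       - (\<Sum>p\<in>UNIV. w k p x * partial i (\<Gamma> p j l) x)
       - (\<Sum>q\<in>UNIV. \<Gamma> q i k x * ?cl q j l x)
       + (\<Sum>p\<in>UNIV. \<Sum>q\<in>UNIV. w p q x * (\<Gamma> p i k x * \<Gamma> q j l x))
       - (\<Sum>q\<in>UNIV. \<Gamma> q i j x * c k q l x)
       - (\<Sum>q\<in>UNIV. ?cl k j q x * \<Gamma> q i l x)
       + (\<Sum>p\<in>UNIV. w k p x * (\<Sum>q\<in>UNIV. \<Gamma> p j q x * \<Gamma> q i l x))" for i j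
      unfolding E_def dc sum.distrib ck cq
      by (simp add: distrib_left distrib_right sum.distrib mult.commute)
    have wR: "(\<Sum>p\<in>UNIV. w k p x * riemann_up h p i j l x) =
       (\<Sum>p\<in>UNIV. w k p x * partial i (\<Gamma> p j l) x) - (\<Sum>p\<in>UNIV. w k p x * partial j (\<Gamma> p i l) x)
       + (\<Sum>p\<in>UNIV. w k p x * (\<Sum>q\<in>UNIV. \<Gamma> p i q x * \<Gamma> q j l x))
       - (\<Sum>p\<in>UNIV. w k p x * (\<Sum>q\<in>UNIV. \<Gamma> p j q x * \<Gamma> q i l x))"
      unfolding riemann_up_def by (simp add: sum.distrib sum_subtractf distrib_left right_diff_distrib)
    show ?thesis
      unfolding E[of i j] E[of j i] wR sym riemann_variation_def
      by (simp add: sum.distrib sum_subtractf right_diff_distrib)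
  qed
  have c: "c k i j y = 1/2 * (?DW [i, j, k] y + ?DW [j, i, k] y - ?DW [k, i, j] y)"
    if y: "y \<in> \<Omega>" for k i j y
  proof -
    have "(\<Sum>p\<in>UNIV. w k p y * \<Gamma> p i j y) = (\<Sum>q\<in>UNIV. \<Gamma> q i j y * w q k y)"
      "(\<Sum>q\<in>UNIV. \<Gamma> q j i y * w q k y) = (\<Sum>q\<in>UNIV. \<Gamma> q i j y * w q k y)"
      "(\<Sum>q\<in>UNIV. \<Gamma> q i k y * w j q y) = (\<Sum>q\<in>UNIV. \<Gamma> q k i y * w q j y)"
      "(\<Sum>q\<in>UNIV. \<Gamma> q k j y * w i q y) = (\<Sum>q\<in>UNIV. \<Gamma> q j k y * w i q y)"
      by (simp_all add: w_commute[OF y, of _ k] w_commute[OF y, of j] christoffel_commute[OF y, of _ j i]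
          christoffel_commute[OF y, of _ k] mult.commute)
    then show ?thesis
      by (simp add: c_def W_def christoffel_low_def cov_deriv_lower_order sum.distrib)
  qed
  have "partial i (c k j l) x = 1/2 * (partial i (?DW [j, l, k]) x + partial i (?DW [l, j, k]) x - partial i (?DW [k, j, l]) x)" for i j k l
  proof -
    have "partial i (c k j l) x = partial i (\<lambda>y. 1/2 * (?DW [j, l, k] y + ?DW [l, j, k] y - ?DW [k, j, l] y)) x"
      by (rule partial_cong[OF open_domain x]) (rule c)
    also have "\<dots> = 1/2 * (partial i (?DW [j, l, k]) x + partial i (?DW [l, j, k]) x - partial i (?DW [k, j, l]) x)"
      by (simp only: partial_rules smooth_facts smooth_DW x partial_const mult_zero_left add_0)
    finally show ?thesis .
  qed
  then have "E i j = 1/2 * (DD [i, j, l, k] x + DD [i, l, j, k] x - DD [i, k, j, l] x)" for i j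
    unfolding E_def DD_def cov_deriv_lower_order(2)[of ?DW] c[OF x]
    by (simp add: sum.distrib sum_subtractf sum_distrib_left algebra_simps)
  then show ?thesis unfolding variation by simp
qed

section \<open>Derivatives of the Ricci tensor\<close>

abbreviation Ric :: "'n list \<Rightarrow> real^'n \<Rightarrow> real" where
  "Ric \<equiv> \<lambda>js. ricci h (js ! 0) (js ! 1)"

lemma cov_deriv_ricci:
  assumes x: "x \<in> \<Omega>"
  shows "cov_deriv h Ric [l, j, k] x = (\<Sum>m\<in>UNIV. \<Sum>n\<in>UNIV. G m n x * DRm [l, j, m, k, n] x)"
proof -
  \<comment> \<open>The summed indices are moved to the front, where \<open>cov_deriv_contraction\<close> expects them.\<close>
  define T where "T js = riemann h (js ! 2) (js ! 0) (js ! 3) (js ! 1)" for js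
  have "cov_deriv h Ric [l, j, k] x
      = cov_deriv h (\<lambda>js x. \<Sum>m\<in>UNIV. \<Sum>n\<in>UNIV. G m n x * T (m # n # js) x) [l, j, k] x"
    by (rule cov_deriv_cong[OF x]) (simp add: ricci_def T_def)
  also have "\<dots> = (\<Sum>m\<in>UNIV. \<Sum>n\<in>UNIV. G m n x * cov_deriv h T [l, m, n, j, k] x)"
    by (rule cov_deriv_contraction[OF x]) (simp add: T_def smooth_riemann)
  finally have "cov_deriv h Ric [l, j, k] x
    = (\<Sum>m\<in>UNIV. \<Sum>n\<in>UNIV. G m n x * cov_deriv h T [l, m, n, j, k] x)" .
  moreover have "cov_deriv h T [l, m, n, j, k] x = DRm [l, j, m, k, n] x" for m n
    by (simp add: T_def cov_deriv_lower_order add_ac)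
  ultimately show ?thesis by simp
qed

text \<open>The second Bianchi identity in the second pair of indices, contracted.\<close>

lemma contracted_bianchi:
  assumes x: "x \<in> \<Omega>"
  shows "cov_deriv h Ric [l, j, k] x - cov_deriv h Ric [k, j, l] x
    = (\<Sum>m\<in>UNIV. \<Sum>n\<in>UNIV. G m n x * DRm [n, j, m, k, l] x)"
proof -
  have "DRm [l, j, m, k, n] x - DRm [k, j, m, l, n] x = DRm [n, j, m, k, l] x" for m n
    using second_bianchi[OF x, of l k n j m] DRm_pair[OF x, of _ j m] DRm_antisym34[OF x, of n j m k l]
      DRm_antisym34[OF x, of k j m n l] by simp
  then show ?thesis
    unfolding cov_deriv_ricci[OF x] by (simp add: sum_subtractf[symmetric] right_diff_distrib[symmetric])
qed

lemma smooth_DRic: "smooth_on \<Omega> (cov_deriv h Ric (p # js))"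
  by (rule smooth_cov_deriv) (rule smooth_ricci)

text \<open>\<open>contracted_bianchi\<close> holds at all points of \<open>\<Omega>\<close> and may be differentiated; the right-hand side is a
  contraction of \<open>\<nabla>R\<close>, so \<open>\<nabla>\<close> passes through it.\<close>

lemma cov_deriv_contracted_bianchi:
  assumes x: "x \<in> \<Omega>"
  shows "cov_deriv h (cov_deriv h Ric) [i, l, j, k] x - cov_deriv h (cov_deriv h Ric) [i, k, j, l] x
    = (\<Sum>m\<in>UNIV. \<Sum>n\<in>UNIV. G m n x * DDRm [i, n, j, m, k, l] x)"
proof -
  let ?DR = "cov_deriv h Ric"
  define S where "S js x = ?DR [js ! 2, js ! 0, js ! 1] x - ?DR [js ! 1, js ! 0, js ! 2] x" for js x
  define T where "T js = DRm [js ! 1, js ! 2, js ! 0, js ! 3, js ! 4]" for js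
  have "partial i (S [j, k, l]) x = partial i (?DR [l, j, k]) x - partial i (?DR [k, j, l]) x"
    unfolding S_def[abs_def] using x smooth_DRic
    by (simp add: partial_smooth_diff)
  then have "cov_deriv h ?DR [i, l, j, k] x - cov_deriv h ?DR [i, k, j, l] x = cov_deriv h S [i, j, k, l] x"
    unfolding cov_deriv_lower_order(2)[of ?DR] cov_deriv_lower_order(2)[of S]
    by (simp add: S_def sum.distrib sum_subtractf right_diff_distrib)
  also have "\<dots> = cov_deriv h (\<lambda>js x. \<Sum>m\<in>UNIV. \<Sum>n\<in>UNIV. G m n x * T (m # n # js) x) [i, j, k, l] x"
  proof (rule cov_deriv_cong[OF x])
    fix js' :: "'n list" and y assume "length js' = length [j, k, l]" and y: "y \<in> \<Omega>"
    then obtain a b c where "js' = [a, b, c]"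
      by (auto simp: length_Suc_conv)
    then show "S js' y = (\<Sum>m\<in>UNIV. \<Sum>n\<in>UNIV. G m n y * T (m # n # js') y)"
      using contracted_bianchi[OF y, of c a b] by (simp add: S_def T_def)
  qed
  also have "\<dots> = (\<Sum>m\<in>UNIV. \<Sum>n\<in>UNIV. G m n x * cov_deriv h T [i, m, n, j, k, l] x)"
    by (rule cov_deriv_contraction[OF x]) (simp add: T_def smooth_DRm)
  finally have "cov_deriv h ?DR [i, l, j, k] x - cov_deriv h ?DR [i, k, j, l] x
    = (\<Sum>m\<in>UNIV. \<Sum>n\<in>UNIV. G m n x * cov_deriv h T [i, m, n, j, k, l] x)" .
  moreover have "cov_deriv h T [i, m, n, j, k, l] x = DDRm [i, n, j, m, k, l] x" for m n
    unfolding cov_deriv_lower_order(4)[of T] cov_deriv_lower_order(4)[of DRm]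
    by (simp add: T_def add_ac)
  ultimately show ?thesis by simp
qed

section \<open>Commutators\<close>

lemma riemann_raise:
  assumes x: "x \<in> \<Omega>"
  shows "riemann_up h s p q a x = (\<Sum>t\<in>UNIV. G s t x * riemann h p q t a x)"
proof -
  have "(\<Sum>t\<in>UNIV. G s t x * riemann h p q t a x)
     = (\<Sum>r\<in>UNIV. (\<Sum>t\<in>UNIV. G s t x * h x $ t $ r) * riemann_up h r p q a x)"
    unfolding riemann_def sum_distrib_left sum_distrib_right
    by (subst sum.swap) (simp add: mult_ac)
  then show ?thesis
    by (simp add: inverse_metric[OF x] if_distrib[of "\<lambda>z. z * _"] cong: if_cong)
qed

lemma DDRm_commutator:
  assumes x: "x \<in> \<Omega>"
  shows "DDRm [p, q, a, b, c, d] x = DDRm [q, p, a, b, c, d] x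
    - (\<Sum>s\<in>UNIV. \<Sum>t\<in>UNIV. G s t x *
       (riemann h p q t a x * riemann h s b c d x + riemann h p q t b x * riemann h a s c d x
      + riemann h p q t c x * riemann h a b s d x + riemann h p q t d x * riemann h a b c s x))"
  using ricci_identity[OF x, of "[a, b, c, d]" Rm p q]
  by (simp add: smooth_riemann_tensor riemann_raise[OF x] lessThan_Suc numeral_eq_Suc
       sum_distrib_right sum.distrib distrib_left algebra_simps)

lemma DDRic_commutator:
  assumes x: "x \<in> \<Omega>"
  shows "cov_deriv h (cov_deriv h Ric) [p, q, a, b] x = cov_deriv h (cov_deriv h Ric) [q, p, a, b] x
    - (\<Sum>s\<in>UNIV. riemann_up h s p q a x * ricci h s b x + riemann_up h s p q b x * ricci h a s x)"
  using ricci_identity[OF x, of "[a, b]" Ric p q]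
  by (simp add: smooth_ricci lessThan_Suc numeral_eq_Suc
       sum.distrib algebra_simps)


section \<open>Quadratic contractions of the curvature tensor\<close>

text \<open>The contraction \<open>g\<^sup>m\<^sup>n g\<^sup>s\<^sup>t f\<^sub>n\<^sub>t u\<^sub>m\<^sub>s\<close>, with \<open>u\<close> for the second argument: the pattern of
  \<open>B_tensor\<close>, with the sums in the order in which \<open>contracted_commutator\<close> meets them.\<close>

definition contract2 :: "('n \<Rightarrow> 'n \<Rightarrow> real) \<Rightarrow> ('n \<Rightarrow> 'n \<Rightarrow> real) \<Rightarrow> real^'n \<Rightarrow> real" where
  "contract2 f g x = (\<Sum>m\<in>UNIV. \<Sum>n\<in>UNIV. \<Sum>s\<in>UNIV. \<Sum>t\<in>UNIV. G m n x * (G s t x * (f n t * g m s)))"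

lemma contract2_cong: "(\<And>p q. f p q = f' p q) \<Longrightarrow> (\<And>p q. g p q = g' p q) \<Longrightarrow> contract2 f g x = contract2 f' g' x"
  by (simp add: contract2_def)

lemma contract2_diff: "contract2 f (\<lambda>p q. g p q - k p q) x = contract2 f g x - contract2 f k x"
  by (simp add: contract2_def right_diff_distrib sum_subtractf)

lemma contract2_commute:
  assumes x: "x \<in> \<Omega>"
  shows "contract2 f g x = contract2 g f x"
proof -
  have "contract2 f g x = (\<Sum>n\<in>UNIV. \<Sum>m\<in>UNIV. \<Sum>s\<in>UNIV. \<Sum>t\<in>UNIV. G m n x * (G s t x * (f n t * g m s)))"
    unfolding contract2_def by (rule sum.swap)
  also have "\<dots> = (\<Sum>n\<in>UNIV. \<Sum>m\<in>UNIV. \<Sum>t\<in>UNIV. \<Sum>s\<in>UNIV. G m n x * (G s t x * (f n t * g m s)))"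
    by (rule sum.cong[OF refl], rule sum.cong[OF refl], rule sum.swap)
  also have "\<dots> = contract2 g f x"
    unfolding contract2_def
    by (intro sum.cong refl) (simp add: inverse_metric_commute[OF x] mult_ac)
  finally show ?thesis .
qed

lemma contract2_transpose: "contract2 (\<lambda>p q. f q p) (\<lambda>p q. g q p) x = contract2 f g x"
proof -
  have "contract2 (\<lambda>p q. f q p) (\<lambda>p q. g q p) x
    = (\<Sum>m\<in>UNIV. \<Sum>s\<in>UNIV. \<Sum>n\<in>UNIV. \<Sum>t\<in>UNIV. G m n x * (G s t x * (f t n * g s m)))"
    unfolding contract2_def by (rule sum.cong[OF refl], rule sum.swap)
  also have "\<dots> = (\<Sum>s\<in>UNIV. \<Sum>m\<in>UNIV. \<Sum>n\<in>UNIV. \<Sum>t\<in>UNIV. G m n x * (G s t x * (f t n * g s m)))"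
    by (rule sum.swap)
  also have "\<dots> = (\<Sum>s\<in>UNIV. \<Sum>m\<in>UNIV. \<Sum>t\<in>UNIV. \<Sum>n\<in>UNIV. G m n x * (G s t x * (f t n * g s m)))"
    by (rule sum.cong[OF refl], rule sum.cong[OF refl], rule sum.swap)
  also have "\<dots> = (\<Sum>s\<in>UNIV. \<Sum>t\<in>UNIV. \<Sum>m\<in>UNIV. \<Sum>n\<in>UNIV. G m n x * (G s t x * (f t n * g s m)))"
    by (rule sum.cong[OF refl], rule sum.swap)
  also have "\<dots> = contract2 f g x"
    unfolding contract2_def by (simp add: mult.left_commute)
  finally show ?thesis .
qed

lemma B_tensor_contract2:
  assumes x: "x \<in> \<Omega>"
  shows "B_tensor h i j k l x = contract2 (\<lambda>p q. riemann h p i q j x) (\<lambda>r s. riemann h r k s l x) x"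
proof -
  let ?t = "\<lambda>p q r s. G p r x * (G q s x * (riemann h p i q j x * riemann h r k s l x))"
  have "B_tensor h i j k l x = (\<Sum>p\<in>UNIV. \<Sum>q\<in>UNIV. \<Sum>r\<in>UNIV. \<Sum>s\<in>UNIV. ?t p q r s)"
    by (simp add: B_tensor_def mult.assoc)
  also have "\<dots> = (\<Sum>p\<in>UNIV. \<Sum>r\<in>UNIV. \<Sum>q\<in>UNIV. \<Sum>s\<in>UNIV. ?t p q r s)"
    by (rule sum.cong[OF refl], rule sum.swap)
  also have "\<dots> = (\<Sum>r\<in>UNIV. \<Sum>p\<in>UNIV. \<Sum>q\<in>UNIV. \<Sum>s\<in>UNIV. ?t p q r s)"
    by (rule sum.swap)
  also have "\<dots> = (\<Sum>r\<in>UNIV. \<Sum>p\<in>UNIV. \<Sum>s\<in>UNIV. \<Sum>q\<in>UNIV. ?t p q r s)"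
    by (rule sum.cong[OF refl], rule sum.cong[OF refl], rule sum.swap)
  also have "\<dots> = contract2 (\<lambda>p q. riemann h p i q j x) (\<lambda>r s. riemann h r k s l x) x"
    unfolding contract2_def
    by (intro sum.cong refl arg_cong2[where f = times]) (simp_all add: inverse_metric_commute[OF x])
  finally show ?thesis .
qed

lemma B_tensor_pair:
  assumes x: "x \<in> \<Omega>"
  shows "B_tensor h k l i j x = B_tensor h i j k l x"
  unfolding B_tensor_contract2[OF x] by (rule contract2_commute[OF x])

lemma B_tensor_flip:
  assumes x: "x \<in> \<Omega>"
  shows "B_tensor h j i l k x = B_tensor h i j k l x"
proof -
  have "contract2 (\<lambda>p q. riemann h p j q i x) (\<lambda>r s. riemann h r l s k x) x
    = contract2 (\<lambda>p q. riemann h q i p j x) (\<lambda>r s. riemann h s k r l x) x"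
    by (rule contract2_cong) (rule riemann_pair[OF x])+
  also have "\<dots> = contract2 (\<lambda>p q. riemann h p i q j x) (\<lambda>r s. riemann h r k s l x) x"
    by (rule contract2_transpose)
  finally show ?thesis unfolding B_tensor_contract2[OF x] .
qed

lemma ricci_commute:
  assumes x: "x \<in> \<Omega>"
  shows "ricci h i k x = ricci h k i x"
  unfolding ricci_def
  by (subst sum.swap, intro sum.cong refl arg_cong2[where f = times])
     (rule inverse_metric_commute[OF x], rule riemann_pair[OF x])

text \<open>The left-hand side is \<open>-g\<^sup>m\<^sup>n[\<nabla>\<^sub>i,\<nabla>\<^sub>n]R\<^sub>j\<^sub>m\<^sub>k\<^sub>l\<close>. Each of the four slots gives one term: the slot \<open>m\<close>,
  summed with \<open>n\<close>, a Ricci tensor, the slots \<open>k\<close> and \<open>l\<close> a \<open>B\<close>, and the slot \<open>j\<close> a difference of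
  two \<open>B\<close> after an application of the first Bianchi identity.\<close>

lemma contracted_commutator:
  assumes x: "x \<in> \<Omega>"
  shows "(\<Sum>m\<in>UNIV. \<Sum>n\<in>UNIV. G m n x * (\<Sum>s\<in>UNIV. \<Sum>t\<in>UNIV. G s t x *
       (riemann h i n t j x * riemann h s m k l x + riemann h i n t m x * riemann h j s k l x
      + riemann h i n t k x * riemann h j m s l x + riemann h i n t l x * riemann h j m k s x)))
    = B_tensor h i j k l x - B_tensor h i j l k x + B_tensor h i k j l x - B_tensor h i l j k x
      - (\<Sum>s\<in>UNIV. \<Sum>t\<in>UNIV. G s t x * (riemann h s j k l x * ricci h t i x))"
proof -
  note anti12 = riemann_antisym12 and anti34 = riemann_antisym34[OF x]
  have 1: "contract2 (\<lambda>n t. riemann h i n t j x) (\<lambda>m s. riemann h s m k l x) x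
     = B_tensor h i j k l x - B_tensor h i j l k x"
  proof -
    \<comment> \<open>First Bianchi identity, after exchanging the two pairs of indices.\<close>
    have "riemann h s m k l x = - (riemann h m k s l x - riemann h m l s k x)" for m s
      using riemann_cyclic[OF x, of k l s m] riemann_pair[OF x, of s m k l] anti12[of l m s k x]
      by linarith
    then have "contract2 (\<lambda>n t. riemann h i n t j x) (\<lambda>m s. riemann h s m k l x) x
      = contract2 (\<lambda>n t. - riemann h n i t j x) (\<lambda>m s. - (riemann h m k s l x - riemann h m l s k x)) x"
      by (intro contract2_cong) (simp_all add: anti12[of i])
    also have "\<dots> = contract2 (\<lambda>n t. riemann h n i t j x) (\<lambda>m s. riemann h m k s l x - riemann h m l s k x) x"
      by (simp only: contract2_def minus_mult_minus)
    finally show ?thesis by (simp add: contract2_diff B_tensor_contract2[OF x])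
  qed
  have 3: "contract2 (\<lambda>n t. riemann h i n t k x) (\<lambda>m s. riemann h j m s l x) x = B_tensor h i k j l x"
    unfolding B_tensor_contract2[OF x] contract2_def by (simp add: anti12[of i] anti12[of j])
  have 4: "contract2 (\<lambda>n t. riemann h i n t l x) (\<lambda>m s. riemann h j m k s x) x = - B_tensor h i l j k x"
    unfolding B_tensor_contract2[OF x] contract2_def
    by (simp add: anti12[of i] anti12[of j] anti34[of _ _ k] sum_negf)
  have "(\<Sum>m\<in>UNIV. \<Sum>n\<in>UNIV. \<Sum>s\<in>UNIV. \<Sum>t\<in>UNIV. G m n x * (G s t x * (riemann h i n t m x * riemann h j s k l x)))
    = (\<Sum>m\<in>UNIV. \<Sum>s\<in>UNIV. \<Sum>n\<in>UNIV. \<Sum>t\<in>UNIV. G m n x * (G s t x * (riemann h i n t m x * riemann h j s k l x)))"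
    by (rule sum.cong[OF refl], rule sum.swap)
  also have "\<dots> = (\<Sum>s\<in>UNIV. \<Sum>m\<in>UNIV. \<Sum>n\<in>UNIV. \<Sum>t\<in>UNIV. G m n x * (G s t x * (riemann h i n t m x * riemann h j s k l x)))"
    by (rule sum.swap)
  also have "\<dots> = (\<Sum>s\<in>UNIV. \<Sum>m\<in>UNIV. \<Sum>t\<in>UNIV. \<Sum>n\<in>UNIV. G m n x * (G s t x * (riemann h i n t m x * riemann h j s k l x)))"
    by (rule sum.cong[OF refl], rule sum.cong[OF refl], rule sum.swap)
  also have "\<dots> = (\<Sum>s\<in>UNIV. \<Sum>t\<in>UNIV. \<Sum>m\<in>UNIV. \<Sum>n\<in>UNIV. G m n x * (G s t x * (riemann h i n t m x * riemann h j s k l x)))"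
    by (rule sum.cong[OF refl], rule sum.swap)
  also have "\<dots> = (\<Sum>s\<in>UNIV. \<Sum>t\<in>UNIV. G s t x * (riemann h j s k l x * (\<Sum>m\<in>UNIV. \<Sum>n\<in>UNIV. G m n x * riemann h i n t m x)))"
    by (simp add: sum_distrib_left mult_ac)
  also have "\<dots> = (\<Sum>s\<in>UNIV. \<Sum>t\<in>UNIV. G s t x * (riemann h j s k l x * ricci h t i x))"
  proof -
    have "(\<Sum>m\<in>UNIV. \<Sum>n\<in>UNIV. G m n x * riemann h i n t m x) = ricci h t i x" for t
      unfolding ricci_def by (intro sum.cong refl arg_cong2[where f = times]) (rule riemann_pair[OF x])
    then show ?thesis by simp
  qed
  also have "\<dots> = - (\<Sum>s\<in>UNIV. \<Sum>t\<in>UNIV. G s t x * (riemann h s j k l x * ricci h t i x))"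
    by (simp add: anti12[of j] sum_negf)
  finally have 2: "(\<Sum>m\<in>UNIV. \<Sum>n\<in>UNIV. \<Sum>s\<in>UNIV. \<Sum>t\<in>UNIV. G m n x * (G s t x * (riemann h i n t m x * riemann h j s k l x)))
     = - (\<Sum>s\<in>UNIV. \<Sum>t\<in>UNIV. G s t x * (riemann h s j k l x * ricci h t i x))" .
  show ?thesis
    unfolding sum_distrib_left distrib_left sum.distrib 2
    using 1 3 4 unfolding contract2_def by simp
qed

text \<open>The Laplacian comes from
  \<open>\<nabla>\<^sub>n\<nabla>\<^sub>jR\<^sub>i\<^sub>m\<^sub>k\<^sub>l - \<nabla>\<^sub>n\<nabla>\<^sub>iR\<^sub>j\<^sub>m\<^sub>k\<^sub>l = \<nabla>\<^sub>n\<nabla>\<^sub>mR\<^sub>i\<^sub>j\<^sub>k\<^sub>l\<close>, the commutators \<open>K\<close> from moving \<open>\<nabla>\<^sub>n\<close> to the front.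
  The remaining commutator, of \<open>\<nabla>\<^sub>i\<close> and \<open>\<nabla>\<^sub>j\<close> on the Ricci tensor, combines with \<open>-2 R\<^sub>k\<^sub>p R\<^sup>p\<^sub>i\<^sub>j\<^sub>l\<close>
  to the last two Ricci terms.\<close>

lemma ricci_variation:
  assumes x: "x \<in> \<Omega>"
  shows "- 2 * riemann_variation h (ricci h) i j k l x =
    laplacian h Rm [i, j, k, l] x
    + 2 * (B_tensor h i j k l x - B_tensor h i j l k x - B_tensor h i l j k x + B_tensor h i k j l x)
    - (\<Sum>p\<in>UNIV. \<Sum>q\<in>UNIV. G p q x *
         (riemann h p j k l x * ricci h q i x + riemann h i p k l x * ricci h q j x
        + riemann h i j p l x * ricci h q k x + riemann h i j k p x * ricci h q l x))"
proof -
  let ?DDR = "cov_deriv h (cov_deriv h Ric)"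
  define K where "K i j = (\<Sum>m\<in>UNIV. \<Sum>n\<in>UNIV. G m n x * (\<Sum>s\<in>UNIV. \<Sum>t\<in>UNIV. G s t x *
       (riemann h i n t j x * riemann h s m k l x + riemann h i n t m x * riemann h j s k l x
      + riemann h i n t k x * riemann h j m s l x + riemann h i n t l x * riemann h j m k s x)))" for i j
  have trace: "(\<Sum>m\<in>UNIV. \<Sum>n\<in>UNIV. G m n x * DDRm [i, n, j, m, k, l] x)
     = (\<Sum>m\<in>UNIV. \<Sum>n\<in>UNIV. G m n x * DDRm [n, i, j, m, k, l] x) - K i j" for i j
    unfolding DDRm_commutator[OF x, of i] K_def
    by (simp add: right_diff_distrib sum_subtractf)
  \<comment> \<open>Second Bianchi identity for the indices \<open>i, j, m\<close>, one of them a derivative.\<close>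
  have "DDRm [n, j, i, m, k, l] x - DDRm [n, i, j, m, k, l] x = DDRm [n, m, i, j, k, l] x" for m n
    using DDRm_bianchi[OF x, of n i j m k l] DDRm_antisym12[OF x, of n j m i k l]
    by simp
  then have "(\<Sum>m\<in>UNIV. \<Sum>n\<in>UNIV. G m n x * DDRm [n, j, i, m, k, l] x)
     - (\<Sum>m\<in>UNIV. \<Sum>n\<in>UNIV. G m n x * DDRm [n, i, j, m, k, l] x)
     = (\<Sum>m\<in>UNIV. \<Sum>n\<in>UNIV. G m n x * DDRm [n, m, i, j, k, l] x)"
    by (simp add: sum_subtractf[symmetric] right_diff_distrib[symmetric])
  also have "\<dots> = laplacian h Rm [i, j, k, l] x"
    unfolding laplacian_def
    by (subst sum.swap) (simp add: inverse_metric_commute[OF x])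
  finally have lap: "(\<Sum>m\<in>UNIV. \<Sum>n\<in>UNIV. G m n x * DDRm [n, j, i, m, k, l] x)
     - (\<Sum>m\<in>UNIV. \<Sum>n\<in>UNIV. G m n x * DDRm [n, i, j, m, k, l] x) = laplacian h Rm [i, j, k, l] x" .
  have K: "K i j - K j i = 2 * (B_tensor h i j k l x - B_tensor h i j l k x - B_tensor h i l j k x + B_tensor h i k j l x)
     - (\<Sum>s\<in>UNIV. \<Sum>t\<in>UNIV. G s t x * (riemann h s j k l x * ricci h t i x))
     - (\<Sum>s\<in>UNIV. \<Sum>t\<in>UNIV. G s t x * (riemann h i s k l x * ricci h t j x))"
    unfolding K_def contracted_commutator[OF x]
    using B_tensor_flip[OF x, of i j k l] B_tensor_flip[OF x, of i j l k]
      B_tensor_pair[OF x, of j k i l] B_tensor_pair[OF x, of j l i k]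
    by (simp add: riemann_antisym12[of i] sum_negf)
  have up: "(\<Sum>s\<in>UNIV. riemann_up h s i j a x * ricci h s b x)
      = (\<Sum>s\<in>UNIV. \<Sum>t\<in>UNIV. G s t x * (riemann h i j s a x * ricci h t b x))" for a b
    unfolding riemann_raise[OF x] sum_distrib_right
    by (subst sum.swap) (simp add: inverse_metric_commute[OF x] mult_ac)
  have "?DDR [i, j, l, k] x - ?DDR [j, i, l, k] x =
     - (\<Sum>s\<in>UNIV. riemann_up h s i j l x * ricci h s k x) - (\<Sum>s\<in>UNIV. riemann_up h s i j k x * ricci h s l x)"
    using DDRic_commutator[OF x, of i j l k]
    by (simp add: sum.distrib ricci_commute[OF x, of l])
  moreover have "(\<Sum>p\<in>UNIV. ricci h k p x * riemann_up h p i j l x) = (\<Sum>s\<in>UNIV. riemann_up h s i j l x * ricci h s k x)"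
    by (simp add: ricci_commute[OF x, of k] mult.commute)
  moreover have "- 2 * riemann_variation h (ricci h) i j k l x = - (?DDR [i, j, l, k] x - ?DDR [j, i, l, k] x)
     - (?DDR [i, l, j, k] x - ?DDR [i, k, j, l] x) + (?DDR [j, l, i, k] x - ?DDR [j, k, i, l] x)
     - 2 * (\<Sum>p\<in>UNIV. ricci h k p x * riemann_up h p i j l x)"
  proof -
    have regroup: "- 2 * v = - (a - d) - (b - c) + (e - f) - 2 * z"
      if "v = 1/2 * (a + b - c - d - e + f) + z" for v a b c d e f z :: real
      using that by (simp add: field_simps)
    have "riemann_variation h (ricci h) i j k l x =
     1/2 * (?DDR [i, j, l, k] x + ?DDR [i, l, j, k] x - ?DDR [i, k, j, l] x
          - ?DDR [j, i, l, k] x - ?DDR [j, l, i, k] x + ?DDR [j, k, i, l] x)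
     + (\<Sum>p\<in>UNIV. ricci h k p x * riemann_up h p i j l x)"
      by (rule riemann_variation_covariant[OF x smooth_ricci ricci_commute])
    then show ?thesis by (rule regroup)
  qed
  ultimately have "- 2 * riemann_variation h (ricci h) i j k l x = laplacian h Rm [i, j, k, l] x + (K i j - K j i)
     - (\<Sum>s\<in>UNIV. riemann_up h s i j l x * ricci h s k x) + (\<Sum>s\<in>UNIV. riemann_up h s i j k x * ricci h s l x)"
    unfolding cov_deriv_contracted_bianchi[OF x] trace using lap by linarith
  then show ?thesis
    unfolding K up
    by (simp add: sum.distrib distrib_left riemann_antisym34[OF x, of i j _ k] sum_negf)
qed

end


lemma (in metric_on) riemann_variation_scale:
  assumes x: "x \<in> \<Omega>" and smooth_v: "\<And>i j. smooth_on \<Omega> (v i j)"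
    and w: "\<And>i j y. y \<in> \<Omega> \<Longrightarrow> w i j y = a * v i j y"
  shows "riemann_variation h w i j k l x = a * riemann_variation h v i j k l x"
proof -
  have low: "christoffel_low w k i j y = a * christoffel_low v k i j y" if "y \<in> \<Omega>" for k i j y
  proof -
    have "partial i (w j k) y = a * partial i (v j k) y" for i j k
      using partial_cong[OF open_domain that, of "w j k" "\<lambda>y. a * v j k y" i] w
        partial_smooth_cmult[OF smooth_v that] by simp
    then show ?thesis by (simp add: christoffel_low_def algebra_simps)
  qed
  have smooth_low_v: "smooth_on \<Omega> (christoffel_low v k i j)" for k i j
    unfolding christoffel_low_def[abs_def] by (intro smooth_rules smooth_v)
  have dlow: "partial i (christoffel_low w k j l) x = a * partial i (christoffel_low v k j l) x" for i j k l
  proof -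
    have "partial i (christoffel_low w k j l) x = partial i (\<lambda>y. a * christoffel_low v k j l y) x"
      by (rule partial_cong[OF open_domain x low])
    also have "\<dots> = a * partial i (christoffel_low v k j l) x"
      by (rule partial_smooth_cmult[OF smooth_low_v x])
    finally show ?thesis .
  qed
  show ?thesis
    unfolding riemann_variation_def dlow low[OF x] w[OF x]
    by (simp add: sum_distrib_left algebra_simps)
qed

section \<open>Time derivatives of the curvature tensor\<close>

lemma DERIV_transform_on:
  assumes "t \<in> S" "\<And>s. s \<in> S \<Longrightarrow> f s = g s" "(g has_field_derivative D) (at t within S)"
  shows "(f has_field_derivative D) (at t within S)"
  by (rule has_field_derivative_transform_within[OF assms(3) zero_less_one assms(1)]) (simp add: assms(2))

lemma DERIV_sum_mult:
  fixes f u :: "'b \<Rightarrow> real \<Rightarrow> real"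
  assumes "\<And>p. (f p has_real_derivative f' p) (at t within S)" "\<And>p. (u p has_real_derivative u' p) (at t within S)"
  shows "((\<lambda>s. \<Sum>p\<in>P. f p s * u p s) has_real_derivative (\<Sum>p\<in>P. f' p * u p t + f p t * u' p)) (at t within S)"
proof (rule DERIV_sum[where f' = "\<lambda>p. f' p * u p t + f p t * u' p"])
  show "((\<lambda>s. f p s * u p s) has_real_derivative f' p * u p t + f p t * u' p) (at t within S)" for p
    using DERIV_mult[OF assms, of p p] by (simp add: add.commute mult.commute)
qed

locale metric_family =
  fixes I :: "real set" and \<Omega> :: "(real^'n::finite) set" and g :: "real \<Rightarrow> real^'n \<Rightarrow> real^'n^'n"
  assumes interval: "is_interval I" "interior I \<noteq> {}"
    and metric: "\<And>t. t \<in> I \<Longrightarrow> metric_on \<Omega> (g t)"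
    and open_space: "open \<Omega>"
    and smooth_family: "\<And>i j. smooth_family_on I \<Omega> (\<lambda>t x. g t x $ i $ j)"
begin

abbreviation g1 :: "'n \<Rightarrow> 'n \<Rightarrow> real \<Rightarrow> real^'n \<Rightarrow> real" where
  "g1 i j \<equiv> time_deriv I (\<lambda>t x. g t x $ i $ j)"
abbreviation g2 :: "'n \<Rightarrow> 'n \<Rightarrow> real \<Rightarrow> real^'n \<Rightarrow> real" where
  "g2 i j \<equiv> time_deriv I (g1 i j)"

lemmas smooth_families = smooth_family smooth_family_time_deriv[OF smooth_family]

lemma deriv_unique:
  assumes "(f has_real_derivative D) (at t within I)" "(f has_real_derivative E) (at t within I)" "t \<in> I"
  shows "D = E"
proof -
  have "time_deriv I (\<lambda>s x. f s) t (0 :: real^'n) = D"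
    by (rule has_real_derivative_time_derivI[OF interval assms(3,1)])
  moreover have "time_deriv I (\<lambda>s x. f s) t (0 :: real^'n) = E"
    by (rule has_real_derivative_time_derivI[OF interval assms(3,2)])
  ultimately show ?thesis by simp
qed

lemma has_time_deriv_partial:
  assumes F: "smooth_family_on I \<Omega> F" and t: "t \<in> I" and x: "x \<in> \<Omega>"
  shows "((\<lambda>s. partial i (F s) x) has_real_derivative partial i (time_deriv I F t) x) (at t within I)"
  using has_time_deriv[OF smooth_family_partial[OF F] t x]
    time_deriv_partial_commute[OF interval open_space F t x] by simp

lemma has_time_deriv_partial2:
  assumes F: "smooth_family_on I \<Omega> F" and t: "t \<in> I" and x: "x \<in> \<Omega>"
  shows "((\<lambda>s. partial i (partial j (F s)) x) has_real_derivative partial i (partial j (time_deriv I F t)) x) (at t within I)"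
proof -
  have "partial i (time_deriv I (\<lambda>s. partial j (F s)) t) x = partial i (partial j (time_deriv I F t)) x"
    by (rule partial_cong[OF open_space x]) (rule time_deriv_partial_commute[OF interval open_space F t])
  then show ?thesis
    using has_time_deriv_partial[OF smooth_family_partial[OF F] t x, of i j] by simp
qed

lemma has_time_deriv_low:
  assumes F: "\<And>i j. smooth_family_on I \<Omega> (F i j)" and t: "t \<in> I" and x: "x \<in> \<Omega>"
  shows "((\<lambda>s. christoffel_low (\<lambda>i j. F i j s) k i j x) has_real_derivative
     christoffel_low (\<lambda>i j. time_deriv I (F i j) t) k i j x) (at t within I)"
  unfolding christoffel_low_def
  by (intro DERIV_cmult DERIV_add DERIV_diff has_time_deriv_partial F t x)

lemma has_time_deriv_partial_low:
  assumes F: "\<And>i j. smooth_family_on I \<Omega> (F i j)" and t: "t \<in> I" and x: "x \<in> \<Omega>"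
  shows "((\<lambda>s. partial m (christoffel_low (\<lambda>i j. F i j s) k i j) x) has_real_derivative
     partial m (christoffel_low (\<lambda>i j. time_deriv I (F i j) t) k i j) x) (at t within I)"
proof -
  have expand: "partial m (christoffel_low (\<lambda>i j. F i j s) k i j) x
    = 1/2 * (partial m (partial i (F j k s)) x + partial m (partial j (F i k s)) x - partial m (partial k (F i j s)) x)"
    if "s \<in> I" "\<And>i j. smooth_family_on I \<Omega> (F i j)" for s and F :: "'n \<Rightarrow> 'n \<Rightarrow> real \<Rightarrow> real^'n \<Rightarrow> real"
  proof -
    interpret metric_on \<Omega> "g s" using metric[OF that(1)] .
    show ?thesis
      unfolding christoffel_low_def[abs_def] using smooth_family_slice[OF that(2) that(1)]
      by (simp only: partial_rules smooth_rules x partial_const mult_zero_left add_0)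
  qed
  show ?thesis
    unfolding expand[OF t smooth_family_time_deriv[OF F]]
  proof (rule DERIV_transform_on[OF t])
    show "((\<lambda>s. 1/2 * (partial m (partial i (F j k s)) x + partial m (partial j (F i k s)) x - partial m (partial k (F i j s)) x))
       has_real_derivative 1/2 * (partial m (partial i (time_deriv I (F j k) t)) x
         + partial m (partial j (time_deriv I (F i k) t)) x - partial m (partial k (time_deriv I (F i j) t)) x)) (at t within I)"
      by (intro DERIV_cmult DERIV_add DERIV_diff has_time_deriv_partial2 F t x)
  qed (simp add: expand F)
qed

lemmas has_time_deriv_metric_low =
  has_time_deriv_low[where F = "\<lambda>i j t x. g t x $ i $ j", OF smooth_families(1)]
  has_time_deriv_low[where F = g1, OF smooth_families(2)]

lemmas has_time_deriv_partial_metric_low =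
  has_time_deriv_partial_low[where F = "\<lambda>i j t x. g t x $ i $ j", OF smooth_families(1)]
  has_time_deriv_partial_low[where F = g1, OF smooth_families(2)]

text \<open>The raised Christoffel symbols contain the inverse metric, so joint smoothness of the metric does not
  apply to them directly; one time derivative at a fixed point is all that the calculation requires.\<close>

lemma has_time_deriv_christoffel:
  assumes t: "t \<in> I" and x: "x \<in> \<Omega>"
  shows "((\<lambda>s. christoffel (g s) p i j x) has_real_derivative
    time_deriv I (\<lambda>s. christoffel (g s) p i j) t x) (at t within I)"
proof -
  have inv: "\<forall>s\<in>I. (\<lambda>s. matrix_inv (g s x) $ k $ l) differentiable (at s within I)" for k l
  proof (rule matrix_inv_entry_closed[where P = "\<lambda>f. \<forall>s\<in>I. f differentiable (at s within I)" and S = I])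
    show "det (g s x) \<noteq> 0" if "s \<in> I" for s
      using metric_on.nonsingular[OF metric[OF that] x] .
    show "\<forall>s\<in>I. (\<lambda>s. g s x $ i $ j) differentiable (at s within I)" for i j
      using has_time_deriv[OF smooth_family _ x] real_differentiable_def by blast
    show "\<forall>s\<in>I. f' differentiable (at s within I)"
      if "\<forall>s\<in>I. f differentiable (at s within I)" "\<And>s. s \<in> I \<Longrightarrow> f s = f' s" for f f' :: "real \<Rightarrow> real"
      using that by (metis differentiable_transform_within zero_less_one)
  qed auto
  have "(\<lambda>s. christoffel_low (\<lambda>i j x. g s x $ i $ j) l i j x) differentiable (at t within I)" for l
    using has_time_deriv_metric_low(1)[OF t x] real_differentiable_def by blast
  then have "(\<lambda>s. \<Sum>l\<in>UNIV. matrix_inv (g s x) $ p $ l * christoffel_low (\<lambda>i j x. g s x $ i $ j) l i j x)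
      differentiable (at t within I)"
    using inv t by (intro differentiable_sum differentiable_mult) auto
  moreover have "(\<Sum>l\<in>UNIV. matrix_inv (g s x) $ p $ l * christoffel_low (\<lambda>i j x. g s x $ i $ j) l i j x)
     = christoffel (g s) p i j x" if "s \<in> I" for s
    using metric_on.christoffel_eq_low[OF metric[OF that]] by (simp add: inv_metric_def)
  ultimately have "(\<lambda>s. christoffel (g s) p i j x) differentiable (at t within I)"
    using t by (metis (no_types, lifting) differentiable_transform_within zero_less_one)
  then show ?thesis
    unfolding time_deriv_def has_real_derivative_iff_has_vector_derivative
    using vector_derivative_works by blast
qed

text \<open>The rule \<open>(a\<cdot>B)'' = a''\<cdot>B + A\<cdot>b'' - A\<cdot>g''B + 2 A'\<cdot>gB'\<close> for \<open>gA = a\<close>, \<open>gB = b\<close>. The first derivative is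
  brought into the form \<open>a'\<cdot>B + A\<cdot>b' - A\<cdot>g'B\<close> by means of \<open>a\<cdot>B' = A\<cdot>gB'\<close> and \<open>gB' = b' - g'B\<close>. No second
  derivative of \<open>A\<close> or \<open>B\<close> is then ever taken; only the lowered symbols are differentiated twice.\<close>

lemma second_time_deriv_quadratic:
  fixes c d e f :: 'n
  assumes x: "x \<in> \<Omega>"
  defines "low0 \<equiv> \<lambda>p i j s. christoffel_low (\<lambda>i j x. g s x $ i $ j) p i j x"
    and "low1 \<equiv> \<lambda>p i j s. christoffel_low (\<lambda>i j. g1 i j s) p i j x"
    and "low2 \<equiv> \<lambda>p i j s. christoffel_low (\<lambda>i j. g2 i j s) p i j x"
    and "\<Gamma>0 \<equiv> \<lambda>p i j s. christoffel (g s) p i j x"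
    and "\<Gamma>1 \<equiv> \<lambda>p i j s. time_deriv I (\<lambda>s. christoffel (g s) p i j) s x"
  defines "Q1 \<equiv> \<lambda>s. (\<Sum>p\<in>UNIV. low1 p c d s * \<Gamma>0 p e f s + \<Gamma>0 p c d s * low1 p e f s)
      - (\<Sum>p\<in>UNIV. \<Sum>q\<in>UNIV. g1 p q s x * (\<Gamma>0 p c d s * \<Gamma>0 q e f s))"
  shows "\<And>s. s \<in> I \<Longrightarrow> ((\<lambda>s. \<Sum>p\<in>UNIV. low0 p c d s * \<Gamma>0 p e f s) has_real_derivative Q1 s) (at s within I)"
    and "\<And>t. t \<in> I \<Longrightarrow> (Q1 has_real_derivative
      (\<Sum>p\<in>UNIV. low2 p c d t * \<Gamma>0 p e f t + \<Gamma>0 p c d t * low2 p e f t)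
      - (\<Sum>p\<in>UNIV. \<Sum>q\<in>UNIV. g2 p q t x * (\<Gamma>0 p c d t * \<Gamma>0 q e f t))
      + 2 * (\<Sum>p\<in>UNIV. \<Sum>q\<in>UNIV. g t x $ p $ q * (\<Gamma>1 p c d t * \<Gamma>1 q e f t))) (at t within I)"
proof -
  have dlow0: "(low0 p i j has_real_derivative low1 p i j s) (at s within I)"
    and dlow1: "(low1 p i j has_real_derivative low2 p i j s) (at s within I)"
    and d\<Gamma>: "(\<Gamma>0 p i j has_real_derivative \<Gamma>1 p i j s) (at s within I)" if "s \<in> I" for p i j s
    unfolding low0_def low1_def low2_def \<Gamma>0_def \<Gamma>1_def
    using has_time_deriv_metric_low[OF that x] has_time_deriv_christoffel[OF that x] by blast+
  note dg0 = has_time_deriv[OF smooth_families(1) _ x]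
  note dg1 = has_time_deriv[OF smooth_families(2) _ x]
  have low0: "low0 p i j s = (\<Sum>q\<in>UNIV. g s x $ p $ q * \<Gamma>0 q i j s)" if "s \<in> I" for p i j s
    using metric_on.lower_christoffel[OF metric[OF that] x] by (simp add: low0_def \<Gamma>0_def)
  have low1: "low1 p i j s = (\<Sum>q\<in>UNIV. g1 p q s x * \<Gamma>0 q i j s + g s x $ p $ q * \<Gamma>1 q i j s)"
    if s: "s \<in> I" for p i j s
  proof (rule deriv_unique[OF dlow0[OF s] _ s])
    show "(low0 p i j has_real_derivative (\<Sum>q\<in>UNIV. g1 p q s x * \<Gamma>0 q i j s + g s x $ p $ q * \<Gamma>1 q i j s)) (at s within I)"
    proof (rule DERIV_transform_on[OF s])
      show "((\<lambda>s. \<Sum>q\<in>UNIV. g s x $ p $ q * \<Gamma>0 q i j s) has_real_derivative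
         (\<Sum>q\<in>UNIV. g1 p q s x * \<Gamma>0 q i j s + g s x $ p $ q * \<Gamma>1 q i j s)) (at s within I)"
        by (rule DERIV_sum_mult) (rule dg0[OF s] d\<Gamma>[OF s])+
    qed (simp add: low0)
  qed
  have gsym: "g s x $ p $ q = g s x $ q $ p" if "s \<in> I" for p q s
    using metric_on.metric_commute[OF metric[OF that] x] .
  have contract: "(\<Sum>p\<in>UNIV. low0 p i j s * u p) = (\<Sum>p\<in>UNIV. \<Gamma>0 p i j s * (\<Sum>q\<in>UNIV. g s x $ p $ q * u q))"
    if "s \<in> I" for i j s u
    unfolding low0[OF that] sum_distrib_left sum_distrib_right
    by (subst sum.swap, intro sum.cong refl) (simp add: gsym[OF that] mult_ac)
  show "((\<lambda>s. \<Sum>p\<in>UNIV. low0 p c d s * \<Gamma>0 p e f s) has_real_derivative Q1 s) (at s within I)" if s: "s \<in> I" for s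
  proof -
    have "((\<lambda>s. \<Sum>p\<in>UNIV. low0 p c d s * \<Gamma>0 p e f s) has_real_derivative
       (\<Sum>p\<in>UNIV. low1 p c d s * \<Gamma>0 p e f s + low0 p c d s * \<Gamma>1 p e f s)) (at s within I)"
      by (rule DERIV_sum_mult) (rule dlow0[OF s] d\<Gamma>[OF s])+
    moreover have "(\<Sum>p\<in>UNIV. low0 p c d s * \<Gamma>1 p e f s)
       = (\<Sum>p\<in>UNIV. \<Gamma>0 p c d s * low1 p e f s) - (\<Sum>p\<in>UNIV. \<Sum>q\<in>UNIV. g1 p q s x * (\<Gamma>0 p c d s * \<Gamma>0 q e f s))"
      unfolding contract[OF s] low1[OF s]
      by (simp add: sum.distrib sum_distrib_left distrib_left mult_ac)
    ultimately show ?thesis by (simp add: Q1_def sum.distrib add_diff_eq)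
  qed
  show "(Q1 has_real_derivative
      (\<Sum>p\<in>UNIV. low2 p c d t * \<Gamma>0 p e f t + \<Gamma>0 p c d t * low2 p e f t)
      - (\<Sum>p\<in>UNIV. \<Sum>q\<in>UNIV. g2 p q t x * (\<Gamma>0 p c d t * \<Gamma>0 q e f t))
      + 2 * (\<Sum>p\<in>UNIV. \<Sum>q\<in>UNIV. g t x $ p $ q * (\<Gamma>1 p c d t * \<Gamma>1 q e f t))) (at t within I)" if t: "t \<in> I" for t
  proof -
    have "(Q1 has_real_derivative
      (\<Sum>p\<in>UNIV. (low2 p c d t * \<Gamma>0 p e f t + low1 p c d t * \<Gamma>1 p e f t)
          + (\<Gamma>1 p c d t * low1 p e f t + \<Gamma>0 p c d t * low2 p e f t))
      - (\<Sum>p\<in>UNIV. \<Sum>q\<in>UNIV. g2 p q t x * (\<Gamma>0 p c d t * \<Gamma>0 q e f t)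
          + g1 p q t x * (\<Gamma>1 p c d t * \<Gamma>0 q e f t + \<Gamma>0 p c d t * \<Gamma>1 q e f t))) (at t within I)"
      (is "(_ has_real_derivative (\<Sum>p\<in>UNIV. ?A p + ?B p) - ?C) _")
    proof -
      have product: "((\<lambda>s. \<Gamma>0 p c d s * \<Gamma>0 q e f s) has_real_derivative
          \<Gamma>1 p c d t * \<Gamma>0 q e f t + \<Gamma>0 p c d t * \<Gamma>1 q e f t) (at t within I)" for p q
        using DERIV_mult[OF d\<Gamma>[OF t] d\<Gamma>[OF t], of p c d q e f] by (simp add: add.commute mult.commute)
      have "((\<lambda>s. \<Sum>p\<in>UNIV. \<Sum>q\<in>UNIV. g1 p q s x * (\<Gamma>0 p c d s * \<Gamma>0 q e f s)) has_real_derivative ?C) (at t within I)"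
        by (rule DERIV_sum[where f' = "\<lambda>p. \<Sum>q\<in>UNIV. g2 p q t x * (\<Gamma>0 p c d t * \<Gamma>0 q e f t)
          + g1 p q t x * (\<Gamma>1 p c d t * \<Gamma>0 q e f t + \<Gamma>0 p c d t * \<Gamma>1 q e f t)"], rule DERIV_sum_mult)
           (rule dg1[OF t] product)+
      moreover have "((\<lambda>s. \<Sum>p\<in>UNIV. low1 p c d s * \<Gamma>0 p e f s) has_real_derivative (\<Sum>p\<in>UNIV. ?A p)) (at t within I)"
        by (rule DERIV_sum_mult) (rule dlow1[OF t] d\<Gamma>[OF t])+
      moreover have "((\<lambda>s. \<Sum>p\<in>UNIV. \<Gamma>0 p c d s * low1 p e f s) has_real_derivative (\<Sum>p\<in>UNIV. ?B p)) (at t within I)"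
        by (rule DERIV_sum_mult) (rule dlow1[OF t] d\<Gamma>[OF t])+
      ultimately show ?thesis
        unfolding Q1_def sum.distrib by (intro DERIV_diff DERIV_add)
    qed
    moreover have "(\<Sum>p\<in>UNIV. low1 p c d t * \<Gamma>1 p e f t)
      = (\<Sum>p\<in>UNIV. \<Sum>q\<in>UNIV. g1 p q t x * (\<Gamma>0 p c d t * \<Gamma>1 q e f t))
      + (\<Sum>p\<in>UNIV. \<Sum>q\<in>UNIV. g t x $ p $ q * (\<Gamma>1 p c d t * \<Gamma>1 q e f t))"
    proof -
      \<comment> \<open>Symmetry is known for the metric only and passes to its derivative.\<close>
      have "g1 p q t x = g1 q p t x" for p q
        by (rule deriv_unique[OF dg0[OF t] _ t], rule DERIV_transform_on[OF t _ dg0[OF t]])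
           (rule gsym)
      then show ?thesis
        unfolding low1[OF t] sum_distrib_right
        by (subst sum.swap) (simp add: gsym[OF t] sum.distrib algebra_simps)
    qed
    moreover have "(\<Sum>p\<in>UNIV. \<Gamma>1 p c d t * low1 p e f t)
      = (\<Sum>p\<in>UNIV. \<Sum>q\<in>UNIV. g1 p q t x * (\<Gamma>1 p c d t * \<Gamma>0 q e f t))
      + (\<Sum>p\<in>UNIV. \<Sum>q\<in>UNIV. g t x $ p $ q * (\<Gamma>1 p c d t * \<Gamma>1 q e f t))"
      unfolding low1[OF t] by (simp add: sum.distrib sum_distrib_left algebra_simps)
    ultimately show ?thesis
      by (simp add: sum.distrib distrib_left) (simp add: algebra_simps)
  qed
qed

text \<open>The linear part of \<open>riemann_low\<close> contributes the lowered Christoffel symbols of \<open>\<partial>\<^sup>2g/\<partial>t\<^sup>2\<close>, the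
  quadratic part is differentiated by \<open>second_time_deriv_quadratic\<close>.\<close>

lemma second_time_deriv_riemann:
  assumes t: "t \<in> I" and x: "x \<in> \<Omega>"
  defines "\<Gamma>1 \<equiv> \<lambda>p i j. time_deriv I (\<lambda>s. christoffel (g s) p i j) t x"
  shows "time_deriv I (time_deriv I (\<lambda>s. riemann (g s) i j k l)) t x
    = riemann_variation (g t) (\<lambda>i j. g2 i j t) i j k l x
      + 2 * (\<Sum>p\<in>UNIV. \<Sum>q\<in>UNIV. g t x $ p $ q * (\<Gamma>1 p i l * \<Gamma>1 q j k - \<Gamma>1 p j l * \<Gamma>1 q i k))"
proof -
  let ?low0 = "\<lambda>p i j s. christoffel_low (\<lambda>i j x. g s x $ i $ j) p i j"
  let ?low1 = "\<lambda>p i j s. christoffel_low (\<lambda>i j. g1 i j s) p i j"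
  let ?low2 = "\<lambda>p i j s. christoffel_low (\<lambda>i j. g2 i j s) p i j"
  note quad = second_time_deriv_quadratic[OF x]
  define Q where "Q c d e f s = (\<Sum>p\<in>UNIV. ?low1 p c d s x * christoffel (g s) p e f x
        + christoffel (g s) p c d x * ?low1 p e f s x)
      - (\<Sum>p\<in>UNIV. \<Sum>q\<in>UNIV. g1 p q s x * (christoffel (g s) p c d x * christoffel (g s) q e f x))" for c d e f s
  define R1 where "R1 s = partial i (?low1 k j l s) x - partial j (?low1 k i l s) x + (Q j k i l s - Q i k j l s)" for s
  have dQ0: "((\<lambda>s. \<Sum>p\<in>UNIV. ?low0 p c d s x * christoffel (g s) p e f x) has_real_derivative Q c d e f s) (at s within I)"
    if "s \<in> I" for c d e f s
    unfolding Q_def by (rule quad(1)[OF that])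
  have dQ: "(Q c d e f has_real_derivative
      (\<Sum>p\<in>UNIV. ?low2 p c d t x * christoffel (g t) p e f x + christoffel (g t) p c d x * ?low2 p e f t x)
      - (\<Sum>p\<in>UNIV. \<Sum>q\<in>UNIV. g2 p q t x * (christoffel (g t) p c d x * christoffel (g t) q e f x))
      + 2 * (\<Sum>p\<in>UNIV. \<Sum>q\<in>UNIV. g t x $ p $ q * (\<Gamma>1 p c d * \<Gamma>1 q e f))) (at t within I)" for c d e f
    unfolding Q_def[abs_def] \<Gamma>1_def by (rule quad(2)[OF t])
  have R1: "((\<lambda>s. riemann (g s) i j k l x) has_real_derivative R1 s) (at s within I)" if s: "s \<in> I" for s
  proof (rule DERIV_transform_on[OF s])
    show "((\<lambda>s. partial i (?low0 k j l s) x - partial j (?low0 k i l s) x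
      + ((\<Sum>p\<in>UNIV. ?low0 p j k s x * christoffel (g s) p i l x)
       - (\<Sum>p\<in>UNIV. ?low0 p i k s x * christoffel (g s) p j l x))) has_real_derivative R1 s) (at s within I)"
      unfolding R1_def by (intro DERIV_add DERIV_diff dQ0 has_time_deriv_partial_metric_low s x)
  qed (simp add: metric_on.riemann_low[OF metric x] sum_subtractf)
  have R2: "(R1 has_real_derivative riemann_variation (g t) (\<lambda>i j. g2 i j t) i j k l x
      + 2 * (\<Sum>p\<in>UNIV. \<Sum>q\<in>UNIV. g t x $ p $ q * (\<Gamma>1 p j k * \<Gamma>1 q i l))
      - 2 * (\<Sum>p\<in>UNIV. \<Sum>q\<in>UNIV. g t x $ p $ q * (\<Gamma>1 p i k * \<Gamma>1 q j l))) (at t within I)"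
    unfolding R1_def[abs_def]
    by (rule DERIV_cong[OF DERIV_add[OF
          DERIV_diff[OF has_time_deriv_partial_metric_low(2)[OF t x] has_time_deriv_partial_metric_low(2)[OF t x]] DERIV_diff[OF dQ dQ]]])
       (simp add: riemann_variation_def sum.distrib sum_subtractf right_diff_distrib)
  have inner: "time_deriv I (\<lambda>s. riemann (g s) i j k l) s x = R1 s" if "s \<in> I" for s
    by (rule has_real_derivative_time_derivI[OF interval that]) (rule R1[OF that])
  have second: "time_deriv I (time_deriv I (\<lambda>s. riemann (g s) i j k l)) t x = riemann_variation (g t) (\<lambda>i j. g2 i j t) i j k l x
      + 2 * (\<Sum>p\<in>UNIV. \<Sum>q\<in>UNIV. g t x $ p $ q * (\<Gamma>1 p j k * \<Gamma>1 q i l))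
      - 2 * (\<Sum>p\<in>UNIV. \<Sum>q\<in>UNIV. g t x $ p $ q * (\<Gamma>1 p i k * \<Gamma>1 q j l))"
    by (rule has_real_derivative_time_derivI[OF interval t], rule DERIV_transform_on[OF t _ R2]) (rule inner)
  have swap: "(\<Sum>p\<in>UNIV. \<Sum>q\<in>UNIV. g t x $ p $ q * (u p * v q)) = (\<Sum>p\<in>UNIV. \<Sum>q\<in>UNIV. g t x $ p $ q * (v p * u q))"
    for u v :: "'n \<Rightarrow> real"
    by (subst sum.swap, intro sum.cong refl) (simp add: metric_on.metric_commute[OF metric[OF t] x] mult_ac)
  from second swap[of "\<lambda>p. \<Gamma>1 p j k" "\<lambda>q. \<Gamma>1 q i l"] swap[of "\<lambda>p. \<Gamma>1 p i k" "\<lambda>q. \<Gamma>1 q j l"]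
  show ?thesis
    by (simp add: right_diff_distrib sum_subtractf)
qed

end

section \<open>The evolution equation\<close>

lemma det_nonzero_if_positive_definite:
  fixes M :: "real^'n::finite^'n"
  assumes "\<And>v. v \<noteq> 0 \<Longrightarrow> v \<bullet> (M *v v) > 0"
  shows "det M \<noteq> 0"
proof -
  have "v = 0" if "M *v v = 0" for v using assms[of v] that by auto
  then have "\<exists>B. B ** M = mat 1" using matrix_left_invertible_ker by blast
  then have "invertible M" using invertible_left_inverse by blast
  then show ?thesis using invertible_det_nz by blast
qed

lemma riemannian_metric_metric_on:
  assumes "riemannian_metric A h" "c \<in> A" "open (chart_image c)"
  shows "metric_on (chart_image c) (h c)"
proof
  have c: "\<forall>i j. smooth_on (chart_image c) (\<lambda>x. h c x $ i $ j)"
    "\<forall>x\<in>chart_image c. transpose (h c x) = h c x \<and> (\<forall>v. v \<noteq> 0 \<longrightarrow> v \<bullet> (h c x *v v) > 0)"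
    using assms(1,2) unfolding riemannian_metric_def by blast+
  show "open (chart_image c)" by fact
  show "smooth_on (chart_image c) (\<lambda>x. h c x $ i $ j)" for i j using c(1) by blast
  show "det (h c x) \<noteq> 0" if "x \<in> chart_image c" for x
    using c(2) that by (intro det_nonzero_if_positive_definite) blast
  show "h c x $ i $ j = h c x $ j $ i" if "x \<in> chart_image c" for x i j
  proof -
    have "transpose (h c x) $ i $ j = h c x $ i $ j" using c(2) that by simp
    then show ?thesis by (simp add: transpose_def)
  qed
qed

theorem theorem1p3:
  fixes X :: "'a topology"
    and A :: "('a, 'n::finite) chart set"
    and I :: "real set"
    and g :: "('a, 'n) chart \<Rightarrow> real \<Rightarrow> real^'n \<Rightarrow> real^'n^'n"
  assumes manifold: "smooth_manifold X A"
    and time_interval: "is_interval I" "interior I \<noteq> {}"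
    and metrics: "smooth_metric_family A I g"
    and complete: "\<forall>t\<in>I. complete_metric X A (\<lambda>c. g c t)"
    and flow: "hyperbolic_geometric_flow A I g"
  shows "\<forall>c\<in>A. \<forall>t\<in>I. \<forall>x\<in>chart_image c. \<forall>i j k l.
    (let h = g c t;
         G = (\<lambda>p q. inv_metric h p q x);
         R = (\<lambda>i j k l. riemann h i j k l x);
         Rc = (\<lambda>i j. ricci h i j x);
         B = (\<lambda>i j k l. B_tensor h i j k l x);
         \<Gamma>' = (\<lambda>p i j. time_deriv I (\<lambda>s. christoffel (g c s) p i j) t x)
     in time_deriv I (time_deriv I (\<lambda>s. riemann (g c s) i j k l)) t x =
          laplacian h (riemann_tensor h) [i, j, k, l] x
          + 2 * (B i j k l - B i j l k - B i l j k + B i k j l)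
          - (\<Sum>p\<in>UNIV. \<Sum>q\<in>UNIV. G p q *
               (R p j k l * Rc q i + R i p k l * Rc q j + R i j p l * Rc q k + R i j k p * Rc q l))
          + 2 * (\<Sum>p\<in>UNIV. \<Sum>q\<in>UNIV. h x $ p $ q *
               (\<Gamma>' p i l * \<Gamma>' q j k - \<Gamma>' p j l * \<Gamma>' q i k)))"
proof (intro ballI allI)
  fix c t x i j k l
  assume c: "c \<in> A" and t: "t \<in> I" and x: "x \<in> chart_image c"
  have open_chart: "open (chart_image c)"
    using manifold c unfolding smooth_manifold_def by blast
  have metric: "metric_on (chart_image c) (g c s)" if "s \<in> I" for s
    using riemannian_metric_metric_on[of A "\<lambda>c. g c s" c] metrics that c open_chart
    unfolding smooth_metric_family_def by blast
  interpret metric_family I "chart_image c" "g c"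
  proof (rule metric_family.intro)
    show "smooth_family_on I (chart_image c) (\<lambda>t x. g c t x $ i $ j)" for i j
      using metrics c unfolding smooth_metric_family_def by blast
  qed (fact time_interval metric open_chart)+
  have "g2 i j t y = - 2 * ricci (g c t) i j y" if "y \<in> chart_image c" for i j y
    using flow c t that unfolding hyperbolic_geometric_flow_def by blast
  then have "riemann_variation (g c t) (\<lambda>i j. g2 i j t) i j k l x
      = - 2 * riemann_variation (g c t) (ricci (g c t)) i j k l x"
    by (rule metric_on.riemann_variation_scale[OF metric[OF t] x metric_on.smooth_ricci[OF metric[OF t]]])
  then show "let h = g c t;
         G = (\<lambda>p q. inv_metric h p q x);
         R = (\<lambda>i j k l. riemann h i j k l x);
         Rc = (\<lambda>i j. ricci h i j x);
         B = (\<lambda>i j k l. B_tensor h i j k l x);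
         \<Gamma>' = (\<lambda>p i j. time_deriv I (\<lambda>s. christoffel (g c s) p i j) t x)
     in time_deriv I (time_deriv I (\<lambda>s. riemann (g c s) i j k l)) t x =
          laplacian h (riemann_tensor h) [i, j, k, l] x
          + 2 * (B i j k l - B i j l k - B i l j k + B i k j l)
          - (\<Sum>p\<in>UNIV. \<Sum>q\<in>UNIV. G p q *
               (R p j k l * Rc q i + R i p k l * Rc q j + R i j p l * Rc q k + R i j k p * Rc q l))
          + 2 * (\<Sum>p\<in>UNIV. \<Sum>q\<in>UNIV. h x $ p $ q *
               (\<Gamma>' p i l * \<Gamma>' q j k - \<Gamma>' p j l * \<Gamma>' q i k))"
    unfolding Let_def second_time_deriv_riemann[OF t x]
    using metric_on.ricci_variation[OF metric[OF t] x, of i j k l] by simp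
qed

end
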